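(* Real trigonometric polynomial Riccati differential equations $A(\theta)Y'=B_0(\theta)+B_1(\theta)Y+B_2(\theta)Y^2$ of degree $\eta\ge 1$ with $B_2(\theta)\not\equiv 0$ have at most $2\eta$ trigonometric polynomial solutions when $\eta\ge 2$, and at most $3$ trigonometric polynomial solutions when $\eta=1$. Moreover, there are equations of this type having any given number of trigonometric polynomial solutions smaller than or equal to these upper bounds.
   Context: $\mathbb{R}_t[\theta]=\mathbb{R}[\cos\theta,\sin\theta]$ is the ring of real trigonometric polynomials. The degree of $F\in\mathbb{R}_t[\theta]$ is the degree of its Fourier series: $\deg F=\nu$ if $F(\theta)=\sum_{k=-\nu}^{\nu}f_ke^{k\theta \mathbf i}$ with $f_k=\overline{f_{-k}}\in\mathbb{C}$ and $f_\nu\neq 0$. A real trigonometric polynomial Riccati differential equation of degree $\eta$ is an equation $A(\theta)Y'=B_0(\theta)+B_1(\theta)Y+B_2(\theta)Y^2$ with $A,B_0,B_1,B_2\in\mathbb{R}_t[\theta]$ and $\eta=\max\{\deg A,\deg B_0,\deg B_1,\deg B_2\}$; the prime denotes $d/d\theta$. A trigonometric polynomial solution is an element $Y\in\mathbb{R}_t[\theta]$ satisfying the equation identically. *)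

theory Defs
  imports "HOL-Analysis.Analysis"
begin

text \<open>The ring \<open>\<real>[cos \<theta>, sin \<theta>]\<close>, as a set of functions of \<open>\<theta>\<close>: its elements are the values
  at \<open>(cos \<theta>, sin \<theta>)\<close> of the real polynomials in two variables.\<close>

definition trig_polys :: "(real \<Rightarrow> real) set" where
  "trig_polys =
     {F. \<exists>p :: real \<times> real \<Rightarrow> real. real_polynomial_function p \<and> F = (\<lambda>\<theta>. p (cos \<theta>, sin \<theta>))}"

definition has_trig_degree :: "(real \<Rightarrow> real) \<Rightarrow> nat \<Rightarrow> bool" where
  "has_trig_degree F \<nu> \<longleftrightarrow>
     (\<exists>f :: int \<Rightarrow> complex.
        (\<forall>k\<in>{- int \<nu>..int \<nu>}. f k = cnj (f (- k))) \<and>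
        f (int \<nu>) \<noteq> 0 \<and>
        (\<forall>\<theta>. complex_of_real (F \<theta>) =
           (\<Sum>k = - int \<nu>..int \<nu>. f k * exp (of_int k * of_real \<theta> * \<i>))))"

text \<open>No \<open>\<nu>\<close> satisfies \<open>has_trig_degree\<close> for the zero function; it gets degree \<open>0\<close> by convention,
  which does not influence a maximum of degrees of several trigonometric polynomials.\<close>

definition trig_deg :: "(real \<Rightarrow> real) \<Rightarrow> nat" where
  "trig_deg F = (if F = (\<lambda>_. 0) then 0 else (THE \<nu>. has_trig_degree F \<nu>))"

text \<open>The coefficient functions \<open>A, B\<^sub>0, B\<^sub>1, B\<^sub>2\<close> represent the equation
  \<open>A Y' = B\<^sub>0 + B\<^sub>1 Y + B\<^sub>2 Y\<^sup>2\<close>.\<close>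

definition riccati_eq ::
  "nat \<Rightarrow> (real \<Rightarrow> real) \<Rightarrow> (real \<Rightarrow> real) \<Rightarrow> (real \<Rightarrow> real) \<Rightarrow> (real \<Rightarrow> real) \<Rightarrow> bool" where
  "riccati_eq \<eta> A B0 B1 B2 \<longleftrightarrow>
     A \<in> trig_polys \<and> B0 \<in> trig_polys \<and> B1 \<in> trig_polys \<and> B2 \<in> trig_polys \<and>
     \<eta> = Max {trig_deg A, trig_deg B0, trig_deg B1, trig_deg B2}"

definition riccati_solutions ::
  "(real \<Rightarrow> real) \<Rightarrow> (real \<Rightarrow> real) \<Rightarrow> (real \<Rightarrow> real) \<Rightarrow> (real \<Rightarrow> real) \<Rightarrow> (real \<Rightarrow> real) set" where
  "riccati_solutions A B0 B1 B2 =
     {Y \<in> trig_polys. \<forall>\<theta>. A \<theta> * deriv Y \<theta> = B0 \<theta> + B1 \<theta> * Y \<theta> + B2 \<theta> * (Y \<theta>)\<^sup>2}"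

end

theory Submission
  imports Defs
    "HOL-Computational_Algebra.Polynomial_Factorial"
    "HOL-Computational_Algebra.Field_as_Ring"
begin

text \<open>
  Write trigonometric polynomials as \<open>e\<^sup>-\<^sup>i\<^sup>n\<^sup>\<theta>\<close> times a complex polynomial in \<open>z = e\<^sup>i\<^sup>\<theta>\<close>. Given
  solutions \<open>Y\<^sub>1, \<dots>, Y\<^sub>m\<close> with \<open>m \<ge> 3\<close>, put \<open>y\<^sub>k = Y\<^sub>k - Y\<^sub>1\<close> and let \<open>y\<^sub>2 = G p\<close>, \<open>y\<^sub>3 = G q\<close> with
  \<open>p, q\<close> coprime. The cross ratio of four solutions is constant, so each \<open>k > 1\<close> has a real
  \<open>c\<^sub>k\<close> with \<open>y\<^sub>k ((1 - c\<^sub>k) q + c\<^sub>k p) = G p q\<close>. The factors \<open>l\<^sub>k = (1 - c\<^sub>k) q + c\<^sub>k p\<close> are therefore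
  pairwise coprime divisors of \<open>G p q\<close>, and with \<open>l\<^sub>1 = p - q\<close> the two equations for \<open>y\<^sub>2, y\<^sub>3\<close> give
  \<open>A (q p' - p q') = B\<^sub>2 H \<Prod>l\<^sub>k\<close> up to a power of \<open>z\<close>. Reality makes all \<open>l\<^sub>k\<close> self-reciprocal
  of the same formal degree \<open>r \<ge> 1\<close>, so that \<open>l\<^sub>k\<close> has \<open>r - 2 s\<^sub>k\<close> nonzero roots, where \<open>s\<^sub>k\<close> is its
  order at \<open>0\<close>, and \<open>s\<^sub>k > 0\<close> for at most one \<open>k\<close>. Counting nonzero roots yields
  \<open>(m - 2) r \<le> 2 \<eta> - 2\<close> if all \<open>s\<^sub>k = 0\<close>, and otherwise \<open>(m - 2) r \<le> 2 \<eta>\<close> with \<open>r \<ge> 2\<close>.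

  The bound \<open>2 \<eta>\<close> is attained by a pencil of half-angle linear forms (\<open>r = 1\<close>), the bound \<open>3\<close> for
  \<open>\<eta> = 1\<close> by \<open>sin \<theta> Y' = 1 - Y\<^sup>2\<close>.
\<close>

section \<open>Trigonometric polynomials in the half angle\<close>

text \<open>\<open>cis\<close> is injective on \<open>{0..pi}\<close>, so the difference of the two
  polynomials would have infinitely many roots.\<close>

lemma poly_eq_on_circle:
  fixes P Q :: "complex poly"
  assumes "\<And>\<theta>. poly P (cis \<theta>) = poly Q (cis \<theta>)"
  shows "P = Q"
proof (rule ccontr)
  assume "P \<noteq> Q"
  then have "finite {z. poly (P - Q) z = 0}"
    by (intro poly_roots_finite) auto
  moreover have "cis ` {0..pi} \<subseteq> {z. poly (P - Q) z = 0}"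
    using assms by auto
  moreover have "inj_on cis {0..pi}"
    by (rule inj_on_inverseI[of _ Arg]) (use pi_gt_zero in \<open>auto intro!: Arg_cis simp del: pi_gt_zero\<close>)
  ultimately have "finite {0..pi}"
    using finite_subset finite_imageD by blast
  then show False by (simp add: infinite_Icc)
qed

text \<open>
  Odd \<open>n\<close> is allowed, so that the linear factors \<open>cos (\<theta>/2) + c sin (\<theta>/2)\<close> are covered; the
  trigonometric polynomials of degree at most \<open>n\<close> are the case \<open>2 * n\<close>. Since \<open>F\<close> is real-valued,
  \<open>P\<close> is automatically self-reciprocal.
\<close>

definition half_trig :: "nat \<Rightarrow> (real \<Rightarrow> real) \<Rightarrow> complex poly \<Rightarrow> bool" where
  "half_trig n F P \<longleftrightarrow>
     degree P \<le> n \<and> (\<forall>\<theta>. of_real (F \<theta>) * cis (\<theta> / 2) ^ n = poly P (cis \<theta>))"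

lemma cis_half_power2: "cis (\<theta> / 2) ^ (2 * n) = cis \<theta> ^ n"
  unfolding power_mult Complex.DeMoivre[of "\<theta> / 2" 2] by simp

lemma half_trig_const: "half_trig 0 (\<lambda>_. c) [:of_real c:]"
  by (simp add: half_trig_def)

lemma half_trig_0: "half_trig n (\<lambda>_. 0) 0"
  by (simp add: half_trig_def)

lemma half_trig_sin_half: "half_trig 1 (\<lambda>\<theta>. sin (\<theta> / 2)) [:\<i> / 2, - \<i> / 2:]"
proof -
  have "of_real (sin x) * cis x = \<i> / 2 + cis (2 * x) * (- \<i> / 2)" for x
    using cos_double_sin[of x] sin_double[of x]
    by (simp add: complex_eq_iff power2_eq_square field_simps)
  from this[of "_ / 2"] show ?thesis
    by (simp add: half_trig_def)
qed

lemma half_trig_cos_half: "half_trig 1 (\<lambda>\<theta>. cos (\<theta> / 2)) [:1 / 2, 1 / 2:]"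
proof -
  have "of_real (cos x) * cis x = 1 / 2 + cis (2 * x) * (1 / 2)" for x
    using cos_double_cos[of x] sin_double[of x]
    by (simp add: complex_eq_iff power2_eq_square field_simps)
  from this[of "_ / 2"] show ?thesis
    by (simp add: half_trig_def)
qed

lemma half_trig_add:
  "half_trig n F P \<Longrightarrow> half_trig n G Q \<Longrightarrow> half_trig n (\<lambda>\<theta>. F \<theta> + G \<theta>) (P + Q)"
  by (auto simp: half_trig_def distrib_right intro: degree_add_le)

lemma half_trig_mult:
  "half_trig n F P \<Longrightarrow> half_trig m G Q \<Longrightarrow> half_trig (n + m) (\<lambda>\<theta>. F \<theta> * G \<theta>) (P * Q)"
  unfolding half_trig_def
proof (intro conjI allI; elim conjE)
  fix \<theta> assume *: "\<forall>\<theta>. of_real (F \<theta>) * cis (\<theta> / 2) ^ n = poly P (cis \<theta>)"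
    "\<forall>\<theta>. of_real (G \<theta>) * cis (\<theta> / 2) ^ m = poly Q (cis \<theta>)"
  show "of_real (F \<theta> * G \<theta>) * cis (\<theta> / 2) ^ (n + m) = poly (P * Q) (cis \<theta>)"
    unfolding poly_mult *(1)[rule_format, symmetric] *(2)[rule_format, symmetric]
    by (simp add: power_add)
qed (use degree_mult_le[of P Q] in linarith)

lemma half_trig_cmult: "half_trig n F P \<Longrightarrow> half_trig n (\<lambda>\<theta>. c * F \<theta>) (smult (of_real c) P)"
  by (auto simp: half_trig_def mult.assoc)

lemma half_trig_diff:
  "half_trig n F P \<Longrightarrow> half_trig n G Q \<Longrightarrow> half_trig n (\<lambda>\<theta>. F \<theta> - G \<theta>) (P - Q)"
  by (auto simp: half_trig_def left_diff_distrib intro: degree_diff_le)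

lemma half_trig_prod:
  assumes "\<And>k. k \<in> K \<Longrightarrow> half_trig (n k) (F k) (P k)"
  shows "half_trig (\<Sum>k\<in>K. n k) (\<lambda>\<theta>. \<Prod>k\<in>K. F k \<theta>) (\<Prod>k\<in>K. P k)"
proof (cases "finite K")
  case True
  then show ?thesis using assms
    by (induction K) (auto intro!: half_trig_mult simp: half_trig_const[of 1, simplified] one_pCons)
qed (use half_trig_const[of 1] in \<open>simp add: one_pCons\<close>)

lemma half_trig_power:
  "half_trig n F P \<Longrightarrow> half_trig (m * n) (\<lambda>\<theta>. F \<theta> ^ m) (P ^ m)"
  by (induction m) (use half_trig_const[of 1] in \<open>auto intro!: half_trig_mult simp: one_pCons\<close>)

text \<open>The factor \<open>z ^ j\<close> matches \<open>cis (\<theta> / 2) ^ (2 * j)\<close>;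
  formal degrees can thus be aligned in steps of two.\<close>

lemma half_trig_raise:
  assumes "half_trig n F P"
  shows "half_trig (n + 2 * j) F (monom 1 j * P)"
proof -
  have "half_trig (2 * j) (\<lambda>_. 1) (monom 1 j)"
    by (simp add: half_trig_def degree_monom_eq poly_monom cis_half_power2)
  from half_trig_mult[OF assms this] show ?thesis by (simp add: mult.commute)
qed

lemma half_trig_raise_le:
  assumes "half_trig (2 * n) F P" "n \<le> m"
  shows "half_trig (2 * m) F (monom 1 (m - n) * P)"
  using half_trig_raise[OF assms(1), of "m - n"] assms(2) by (simp add: algebra_simps)

lemma half_trig_unique:
  assumes "half_trig n F P" "half_trig n F Q"
  shows "P = Q"
  using assms by (intro poly_eq_on_circle) (auto simp: half_trig_def)

lemma half_trig_eq_0_iff: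
  assumes "half_trig n F P"
  shows "F = (\<lambda>_. 0) \<longleftrightarrow> P = 0"
proof
  assume "P = 0"
  then show "F = (\<lambda>_. 0)" using assms by (auto simp: half_trig_def fun_eq_iff)
qed (use half_trig_unique[OF assms] half_trig_0 in blast)

text \<open>Polynomials form an integral domain, so a factor such as \<open>A\<close> can be
  cancelled although it may vanish at some angles.\<close>

lemma half_trig_mult_eq_0:
  assumes "half_trig n F P" "half_trig m G Q" "\<And>\<theta>. F \<theta> * G \<theta> = 0"
  shows "F = (\<lambda>_. 0) \<or> G = (\<lambda>_. 0)"
  using half_trig_eq_0_iff[OF half_trig_mult[OF assms(1,2)]] half_trig_eq_0_iff[OF assms(1)]
    half_trig_eq_0_iff[OF assms(2)] assms(3) by auto

text \<open>With \<open>z = cis \<theta>\<close>, \<open>F\<close> is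
  \<open>cis (- n * \<theta> / 2) * poly P z\<close>; the derivative of the first factor contributes
  the term with \<open>n / 2\<close>, and the formal degree is kept.\<close>

lemma half_trig_deriv:
  assumes "half_trig n F P"
  shows "(F has_real_derivative deriv F \<theta>) (at \<theta>)"
    and "half_trig n (deriv F) (smult \<i> (monom 1 1 * pderiv P - smult (of_nat n / 2) P))"
proof -
  define g where "g \<theta> = cis (- (real n * \<theta> / 2)) * poly P (cis \<theta>)" for \<theta>
  define g' where "g' \<theta> = \<i> * cis (- (real n * \<theta> / 2)) *
      (cis \<theta> * poly (pderiv P) (cis \<theta>) - of_nat n / 2 * poly P (cis \<theta>))" for \<theta>
  have cis_der: "(cis has_vector_derivative \<i> * cis \<theta>) (at \<theta>)" for \<theta>
    using has_derivative_cis[OF has_derivative_ident, of \<theta> UNIV]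
    by (simp add: has_vector_derivative_def mult_ac scaleR_conv_of_real)
  have g: "(g has_vector_derivative g' \<theta>) (at \<theta>)" for \<theta>
  proof -
    have "((\<lambda>x. cis (- (real n * x / 2))) has_vector_derivative
        - (real n / 2) *\<^sub>R (\<i> * cis (- (real n * \<theta> / 2)))) (at \<theta>)"
      by (rule vector_diff_chain_at[OF _ cis_der, unfolded o_def])
        (auto intro!: derivative_eq_intros simp: has_real_derivative_iff_has_vector_derivative[symmetric])
    moreover have "((\<lambda>x. poly P (cis x)) has_vector_derivative
        (\<i> * cis \<theta>) * poly (pderiv P) (cis \<theta>)) (at \<theta>)"
      by (rule field_vector_diff_chain_at[OF cis_der poly_DERIV, unfolded o_def])
    ultimately have "(g has_vector_derivative
        (cis (- (real n * \<theta> / 2)) * ((\<i> * cis \<theta>) * poly (pderiv P) (cis \<theta>))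
         + - (real n / 2) *\<^sub>R (\<i> * cis (- (real n * \<theta> / 2))) * poly P (cis \<theta>))) (at \<theta>)"
      unfolding g_def by (rule has_vector_derivative_mult)
    then show ?thesis
      by (simp add: g'_def algebra_simps scaleR_conv_of_real)
  qed
  have cancel: "cis (\<theta> / 2) ^ n * cis (- (real n * \<theta> / 2)) = 1" for \<theta>
    unfolding Complex.DeMoivre cis_mult by simp
  have F: "of_real (F \<theta>) = g \<theta>" for \<theta>
  proof -
    have "of_real (F \<theta>) * cis (\<theta> / 2) ^ n * cis (- (real n * \<theta> / 2)) = g \<theta>"
      using assms by (simp add: half_trig_def g_def)
    then show ?thesis by (simp add: cancel mult.assoc)
  qed
  \<comment> \<open>\<open>g\<close> has zero imaginary part, hence so has \<open>g'\<close>, and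
    \<open>g'\<close> is the derivative of \<open>F\<close> itself.\<close>
  then have "F = Re \<circ> g" and Im: "(\<lambda>\<theta>. Im (g \<theta>)) = (\<lambda>_. 0)"
    by (auto simp: fun_eq_iff) (metis Re_complex_of_real, metis Im_complex_of_real)
  have Fder: "(F has_real_derivative Re (g' \<theta>)) (at \<theta>)" for \<theta>
    unfolding \<open>F = Re \<circ> g\<close> o_def has_real_derivative_iff_has_vector_derivative
    by (rule bounded_linear.has_vector_derivative[OF bounded_linear_Re g])
  then show "(F has_real_derivative deriv F \<theta>) (at \<theta>)"
    by (metis DERIV_imp_deriv)
  have "((\<lambda>\<theta>. Im (g \<theta>)) has_vector_derivative Im (g' \<theta>)) (at \<theta>)" for \<theta>
    by (rule bounded_linear.has_vector_derivative[OF bounded_linear_Im g])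
  then have "Im (g' \<theta>) = 0" for \<theta>
    unfolding Im has_real_derivative_iff_has_vector_derivative[symmetric]
    using DERIV_unique DERIV_const by blast
  then have "of_real (deriv F \<theta>) = g' \<theta>" for \<theta>
    using DERIV_imp_deriv[OF Fder] by (simp add: complex_eq_iff)
  then have "of_real (deriv F \<theta>) * cis (\<theta> / 2) ^ n
      = (cis (\<theta> / 2) ^ n * cis (- (real n * \<theta> / 2))) *
        (\<i> * (cis \<theta> * poly (pderiv P) (cis \<theta>) - of_nat n / 2 * poly P (cis \<theta>)))" for \<theta>
    by (simp only: g'_def mult_ac)
  moreover have "degree (monom 1 1 * pderiv P) \<le> n"
  proof (cases "pderiv P = 0")
    case False
    then have "degree P \<noteq> 0" by (simp add: pderiv_eq_0_iff)
    then show ?thesis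
      using assms False by (simp add: degree_mult_eq degree_monom_eq degree_pderiv half_trig_def)
  qed simp
  ultimately show "half_trig n (deriv F) (smult \<i> (monom 1 1 * pderiv P - smult (of_nat n / 2) P))"
    using assms unfolding half_trig_def
    by (auto intro!: order_trans[OF degree_smult_le] degree_diff_le simp: poly_monom cancel)
qed

section \<open>Degree\<close>

lemma trig_polys_const: "(\<lambda>_. c) \<in> trig_polys"
  by (auto simp: trig_polys_def intro!: exI[of _ "\<lambda>_. c"])

lemma trig_polys_add:
  assumes "F \<in> trig_polys" "G \<in> trig_polys"
  shows "(\<lambda>\<theta>. F \<theta> + G \<theta>) \<in> trig_polys"
proof -
  from assms obtain p q where "real_polynomial_function p" "F = (\<lambda>\<theta>. p (cos \<theta>, sin \<theta>))"
    "real_polynomial_function q" "G = (\<lambda>\<theta>. q (cos \<theta>, sin \<theta>))"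
    by (auto simp: trig_polys_def)
  then show ?thesis
    unfolding trig_polys_def
    by (auto intro!: exI[of _ "\<lambda>x. p x + q x"] real_polynomial_function.intros(3))
qed

lemma trig_polys_mult:
  assumes "F \<in> trig_polys" "G \<in> trig_polys"
  shows "(\<lambda>\<theta>. F \<theta> * G \<theta>) \<in> trig_polys"
proof -
  from assms obtain p q where "real_polynomial_function p" "F = (\<lambda>\<theta>. p (cos \<theta>, sin \<theta>))"
    "real_polynomial_function q" "G = (\<lambda>\<theta>. q (cos \<theta>, sin \<theta>))"
    by (auto simp: trig_polys_def)
  then show ?thesis
    unfolding trig_polys_def
    by (auto intro!: exI[of _ "\<lambda>x. p x * q x"] real_polynomial_function.intros(4))
qed

lemma trig_polys_cmult: "F \<in> trig_polys \<Longrightarrow> (\<lambda>\<theta>. c * F \<theta>) \<in> trig_polys"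
  by (rule trig_polys_mult[OF trig_polys_const])

lemma trig_polys_diff: "F \<in> trig_polys \<Longrightarrow> G \<in> trig_polys \<Longrightarrow> (\<lambda>\<theta>. F \<theta> - G \<theta>) \<in> trig_polys"
  using trig_polys_add[OF _ trig_polys_cmult[of G "-1"]] by simp

lemma trig_polys_sum:
  "(\<And>k. k \<in> K \<Longrightarrow> F k \<in> trig_polys) \<Longrightarrow> (\<lambda>\<theta>. \<Sum>k\<in>K. F k \<theta>) \<in> trig_polys"
  by (induction K rule: infinite_finite_induct) (auto intro: trig_polys_const trig_polys_add)

lemma trig_polys_cos_sin: "cos \<in> trig_polys" "sin \<in> trig_polys"
  using real_polynomial_function.intros(1)[OF bounded_linear_fst]
    real_polynomial_function.intros(1)[OF bounded_linear_snd]
  unfolding trig_polys_def by (force intro!: exI[of _ fst], force intro!: exI[of _ snd])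

lemma trig_polys_cos_sin_nat:
  "(\<lambda>\<theta>. cos (real n * \<theta>)) \<in> trig_polys \<and> (\<lambda>\<theta>. sin (real n * \<theta>)) \<in> trig_polys"
proof (induction n)
  case (Suc n)
  then show ?case
    by (auto simp: distrib_right cos_add sin_add
        intro!: trig_polys_add trig_polys_diff trig_polys_mult trig_polys_cos_sin)
qed (simp add: trig_polys_const)

lemma trig_polys_cos_sin_int:
  "(\<lambda>\<theta>. cos (of_int k * \<theta>)) \<in> trig_polys \<and> (\<lambda>\<theta>. sin (of_int k * \<theta>)) \<in> trig_polys"
  using trig_polys_cos_sin_nat[of "nat \<bar>k\<bar>"]
    trig_polys_cmult[of "\<lambda>\<theta>. sin (real (nat \<bar>k\<bar>) * \<theta>)" "-1"]
  by (cases "k \<ge> 0") auto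

lemma poly_eq_sum: "degree P \<le> n \<Longrightarrow> poly (P :: complex poly) z = (\<Sum>k\<le>n. coeff P k * z ^ k)"
  unfolding poly_altdef by (rule sum.mono_neutral_left) (auto simp: coeff_eq_0)

lemma coeff_sum_monom: "coeff (\<Sum>j\<le>n. monom (f j) j) k = (if k \<le> n then f k else 0)"
  by (simp add: coeff_sum)

text \<open>Taking real parts in the Fourier sum turns each term into a real combination of
  \<open>cos\<close> and \<open>sin\<close> of an integer multiple of \<theta>.\<close>

lemma half_trig_imp_trig_polys:
  assumes "half_trig (2 * n) F P"
  shows "F \<in> trig_polys"
proof -
  have "F \<theta> = (\<Sum>k\<le>2*n. Re (coeff P k) * cos (of_int (int k - int n) * \<theta>)
                      - Im (coeff P k) * sin (of_int (int k - int n) * \<theta>))" for \<theta>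
  proof -
    have "of_real (F \<theta>) * cis \<theta> ^ n = (\<Sum>k\<le>2*n. coeff P k * cis \<theta> ^ k)"
      using assms poly_eq_sum[of P "2 * n"] by (auto simp: half_trig_def cis_half_power2)
    then have "of_real (F \<theta>) * (cis \<theta> ^ n * cis (- (real n * \<theta>)))
        = (\<Sum>k\<le>2*n. coeff P k * (cis \<theta> ^ k * cis (- (real n * \<theta>))))"
      by (simp only: mult.assoc[symmetric] sum_distrib_right[symmetric])
    moreover have "cis \<theta> ^ k * cis (- (real n * \<theta>)) = cis (of_int (int k - int n) * \<theta>)" for k
      unfolding Complex.DeMoivre cis_mult by (simp add: algebra_simps)
    moreover from this[of n] have "cis \<theta> ^ n * cis (- (real n * \<theta>)) = 1"
      by simp
    ultimately have "of_real (F \<theta>) = (\<Sum>k\<le>2*n. coeff P k * cis (of_int (int k - int n) * \<theta>))"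
      by (simp only: mult_1_right)
    then have "F \<theta> = Re (\<Sum>k\<le>2*n. coeff P k * cis (of_int (int k - int n) * \<theta>))"
      by (metis Re_complex_of_real)
    then show ?thesis by simp
  qed
  then have "F = (\<lambda>\<theta>. \<Sum>k\<le>2*n. Re (coeff P k) * cos (of_int (int k - int n) * \<theta>)
                      - Im (coeff P k) * sin (of_int (int k - int n) * \<theta>))" ..
  also have "\<dots> \<in> trig_polys"
    using trig_polys_cos_sin_int
    by (intro trig_polys_sum trig_polys_diff trig_polys_cmult) blast+
  finally show ?thesis .
qed

lemma trig_polys_imp_half_trig:
  assumes "F \<in> trig_polys"
  obtains n P where "half_trig (2 * n) F P"
proof -
  obtain p where p: "real_polynomial_function p" and F: "F = (\<lambda>\<theta>. p (cos \<theta>, sin \<theta>))"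
    using assms by (auto simp: trig_polys_def)
  from p have "\<exists>n P. half_trig (2 * n) (\<lambda>\<theta>. p (cos \<theta>, sin \<theta>)) P"
  proof induction
    \<comment> \<open>A linear functional is determined by its values at \<open>(1, 0)\<close> and
      \<open>(0, 1)\<close>, so it suffices to represent \<open>cos\<close> and \<open>sin\<close>;
      both come from the half-angle forms by the double-angle formulas.\<close>
    case (linear f)
    have cos: "half_trig 2 cos ([:1/2, 1/2:] * [:1/2, 1/2:] - [:\<i>/2, -\<i>/2:] * [:\<i>/2, -\<i>/2:])"
    proof -
      have "cos = (\<lambda>\<theta>. cos (\<theta>/2) * cos (\<theta>/2) - sin (\<theta>/2) * sin (\<theta>/2 :: real))"
      proof
        show "cos \<theta> = cos (\<theta>/2) * cos (\<theta>/2) - sin (\<theta>/2) * sin (\<theta>/2)" for \<theta> :: real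
          using cos_add[of "\<theta>/2" "\<theta>/2"] by simp
      qed
      then show ?thesis
        using half_trig_diff[OF half_trig_mult[OF half_trig_cos_half half_trig_cos_half]
            half_trig_mult[OF half_trig_sin_half half_trig_sin_half]]
        by (simp only: one_add_one)
    qed
    have sin: "half_trig 2 sin (smult (of_real 2) ([:\<i>/2, -\<i>/2:] * [:1/2, 1/2:]))"
    proof -
      have "sin = (\<lambda>\<theta>. 2 * (sin (\<theta>/2) * cos (\<theta>/2 :: real)))"
      proof
        show "sin \<theta> = 2 * (sin (\<theta>/2) * cos (\<theta>/2))" for \<theta> :: real
          using sin_double[of "\<theta>/2"] by simp
      qed
      then show ?thesis
        using half_trig_cmult[OF half_trig_mult[OF half_trig_sin_half half_trig_cos_half], of 2]
        by (simp only: one_add_one)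
    qed
    interpret bounded_linear f by fact
    have "f (x, y) = f (1, 0) * x + f (0, 1) * y" for x y
      using add[of "(x, 0)" "(0, y)"] scaleR[of x "(1, 0)"] scaleR[of y "(0, 1)"]
      by (simp add: mult.commute)
    then have "(\<lambda>\<theta>. f (cos \<theta>, sin \<theta>)) = (\<lambda>\<theta>. f (1, 0) * cos \<theta> + f (0, 1) * sin \<theta>)"
      by blast
    then have "half_trig (2 * 1) (\<lambda>\<theta>. f (cos \<theta>, sin \<theta>))
        (smult (of_real (f (1, 0))) ([:1/2, 1/2:] * [:1/2, 1/2:] - [:\<i>/2, -\<i>/2:] * [:\<i>/2, -\<i>/2:])
         + smult (of_real (f (0, 1))) (smult (of_real 2) ([:\<i>/2, -\<i>/2:] * [:1/2, 1/2:])))"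
      using half_trig_add[OF half_trig_cmult[OF cos] half_trig_cmult[OF sin]] by (simp only: mult_1_right)
    then show ?case by blast
  next
    case (const c)
    show ?case using half_trig_const[of c] by (metis mult_0_right)
  next
    case (add f g)
    then obtain n P m Q where "half_trig (2 * n) (\<lambda>\<theta>. f (cos \<theta>, sin \<theta>)) P"
      "half_trig (2 * m) (\<lambda>\<theta>. g (cos \<theta>, sin \<theta>)) Q" by blast
    from half_trig_raise[OF this(1), of m] half_trig_raise[OF this(2), of n]
    have "half_trig (2 * (n + m)) (\<lambda>\<theta>. f (cos \<theta>, sin \<theta>)) (monom 1 m * P)"
      "half_trig (2 * (n + m)) (\<lambda>\<theta>. g (cos \<theta>, sin \<theta>)) (monom 1 n * Q)"
      by (simp_all add: distrib_left add.commute)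
    from half_trig_add[OF this] show ?case by blast
  next
    case (mult f g)
    then obtain n P m Q where "half_trig (2 * n) (\<lambda>\<theta>. f (cos \<theta>, sin \<theta>)) P"
      "half_trig (2 * m) (\<lambda>\<theta>. g (cos \<theta>, sin \<theta>)) Q" by blast
    from half_trig_mult[OF this]
    have "half_trig (2 * (n + m)) (\<lambda>\<theta>. f (cos \<theta>, sin \<theta>) * g (cos \<theta>, sin \<theta>)) (P * Q)"
      by (simp add: distrib_left)
    then show ?case by blast
  qed
  then show ?thesis using that F by blast
qed

text \<open>For \<open>degree P \<le> n\<close> this is the conjugate reciprocal
  \<open>z ^ n * cnj (P (1 / cnj z))\<close>; on the unit circle
  \<open>1 / cnj z = z\<close>.\<close>

definition conj_reflect :: "nat \<Rightarrow> complex poly \<Rightarrow> complex poly" where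
  "conj_reflect n P = (\<Sum>k\<le>n. monom (cnj (coeff P (n - k))) k)"

lemma coeff_conj_reflect: "coeff (conj_reflect n P) k = (if k \<le> n then cnj (coeff P (n - k)) else 0)"
  by (simp add: conj_reflect_def coeff_sum_monom)

lemma degree_conj_reflect: "degree (conj_reflect n P) \<le> n"
  by (rule degree_le) (simp add: coeff_conj_reflect)

lemma poly_conj_reflect:
  assumes "degree P \<le> n"
  shows "poly (conj_reflect n P) (cis \<theta>) = cis \<theta> ^ n * cnj (poly P (cis \<theta>))"
proof -
  have "poly (conj_reflect n P) (cis \<theta>) = (\<Sum>k\<le>n. cnj (coeff P (n - k)) * cis \<theta> ^ k)"
    unfolding poly_eq_sum[OF degree_conj_reflect] by (simp add: coeff_conj_reflect)
  also have "\<dots> = (\<Sum>k\<le>n. cnj (coeff P k) * cis \<theta> ^ (n - k))"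
    by (rule sum.reindex_bij_witness[of _ "\<lambda>k. n - k" "\<lambda>k. n - k"]) auto
  also have "\<dots> = (\<Sum>k\<le>n. cis \<theta> ^ n * cnj (coeff P k * cis \<theta> ^ k))"
  proof (rule sum.cong)
    fix k assume "k \<in> {..n}"
    then have "cis \<theta> ^ n = cis \<theta> ^ (n - k) * cis \<theta> ^ k" by (simp flip: power_add)
    moreover have "cis \<theta> ^ k * cnj (cis \<theta> ^ k) = 1"
      unfolding Complex.DeMoivre cis_cnj cis_mult by simp
    ultimately show "cnj (coeff P k) * cis \<theta> ^ (n - k) = cis \<theta> ^ n * cnj (coeff P k * cis \<theta> ^ k)"
      by (simp add: mult_ac)
  qed simp
  finally show ?thesis
    unfolding poly_eq_sum[OF assms] cnj_sum sum_distrib_left .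
qed

text \<open>Conjugation fixes the real \<open>F\<close> and inverts
  \<open>cis (\<theta> / 2)\<close>, which amounts to the reflection at formal degree
  \<open>n\<close>.\<close>

lemma half_trig_conj_reflect:
  assumes "half_trig n F P"
  shows "conj_reflect n P = P"
proof (rule poly_eq_on_circle)
  fix \<theta>
  have "cis \<theta> ^ n * cnj (cis (\<theta> / 2) ^ n) = cis (\<theta> / 2) ^ n"
    unfolding Complex.DeMoivre cis_cnj cis_mult by (simp add: field_simps)
  moreover have "degree P \<le> n" and P: "poly P (cis \<theta>) = of_real (F \<theta>) * cis (\<theta> / 2) ^ n"
    using assms by (simp_all add: half_trig_def)
  ultimately show "poly (conj_reflect n P) (cis \<theta>) = poly P (cis \<theta>)"
    by (simp add: poly_conj_reflect P mult.left_commute)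
qed

lemma half_trig_coeff:
  assumes "half_trig n F P" "k \<le> n"
  shows "coeff P k = cnj (coeff P (n - k))"
  using half_trig_conj_reflect[OF assms(1)] coeff_conj_reflect[of n P k] assms(2) by simp

text \<open>Multiplying the Fourier series by \<open>z ^ \<nu>\<close> shifts the indices to
  \<open>0..2 * \<nu>\<close>; the symmetry of the Fourier coefficients is
  \<open>half_trig_coeff\<close>.\<close>

lemma has_trig_degree_iff:
  "has_trig_degree F \<nu> \<longleftrightarrow> (\<exists>P. half_trig (2 * \<nu>) F P \<and> coeff P (2 * \<nu>) \<noteq> 0)"
proof -
  have fourier: "(\<Sum>k = - int \<nu>..int \<nu>. f k * exp (of_int k * of_real \<theta> * \<i>)) * cis \<theta> ^ \<nu>
      = (\<Sum>j\<le>2*\<nu>. f (int j - int \<nu>) * cis \<theta> ^ j)" for f :: "int \<Rightarrow> complex" and \<theta> :: real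
  proof -
    have "exp (of_int k * of_real \<theta> * \<i>) * cis \<theta> ^ \<nu> = cis \<theta> ^ nat (k + int \<nu>)"
      if "- int \<nu> \<le> k" for k
    proof -
      have "exp (of_int k * of_real \<theta> * \<i>) = cis (of_int k * \<theta>)"
        by (simp add: cis_conv_exp mult_ac)
      then show ?thesis using that
        unfolding Complex.DeMoivre by (simp add: cis_mult algebra_simps)
    qed
    then have "(\<Sum>k = - int \<nu>..int \<nu>. f k * exp (of_int k * of_real \<theta> * \<i>)) * cis \<theta> ^ \<nu>
        = (\<Sum>k = - int \<nu>..int \<nu>. f k * cis \<theta> ^ nat (k + int \<nu>))"
      by (auto simp: sum_distrib_right mult.assoc intro!: sum.cong)
    also have "\<dots> = (\<Sum>j\<le>2*\<nu>. f (int j - int \<nu>) * cis \<theta> ^ j)"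
      by (rule sum.reindex_bij_witness[of _ "\<lambda>j. int j - int \<nu>" "\<lambda>k. nat (k + int \<nu>)"]) auto
    finally show ?thesis .
  qed
  show ?thesis
  proof
    assume "has_trig_degree F \<nu>"
    then obtain f where f: "f (int \<nu>) \<noteq> 0"
      "\<And>\<theta>. of_real (F \<theta>) = (\<Sum>k = - int \<nu>..int \<nu>. f k * exp (of_int k * of_real \<theta> * \<i>))"
      unfolding has_trig_degree_def by blast
    let ?P = "\<Sum>j\<le>2*\<nu>. monom (f (int j - int \<nu>)) j"
    have "half_trig (2 * \<nu>) F ?P"
      unfolding half_trig_def f(2) cis_half_power2 fourier
      by (auto simp: coeff_sum_monom poly_sum poly_monom intro!: degree_le)
    moreover have "coeff ?P (2 * \<nu>) \<noteq> 0" using f(1) by (simp add: coeff_sum_monom)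
    ultimately show "\<exists>P. half_trig (2 * \<nu>) F P \<and> coeff P (2 * \<nu>) \<noteq> 0" by blast
  next
    assume "\<exists>P. half_trig (2 * \<nu>) F P \<and> coeff P (2 * \<nu>) \<noteq> 0"
    then obtain P where P: "half_trig (2 * \<nu>) F P" "coeff P (2 * \<nu>) \<noteq> 0" by blast
    define f where "f k = coeff P (nat (k + int \<nu>))" for k
    have "f k = cnj (f (- k))" if "k \<in> {- int \<nu>..int \<nu>}" for k
    proof -
      have "2 * \<nu> - nat (k + int \<nu>) = nat (- k + int \<nu>)" "nat (k + int \<nu>) \<le> 2 * \<nu>"
        using that by auto
      then show ?thesis
        unfolding f_def using half_trig_coeff[OF P(1)] by metis
    qed
    moreover have "nat (int \<nu> + int \<nu>) = 2 * \<nu>" by simp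
    then have "f (int \<nu>) \<noteq> 0" using P(2) unfolding f_def by metis
    moreover have "of_real (F \<theta>) = (\<Sum>k = - int \<nu>..int \<nu>. f k * exp (of_int k * of_real \<theta> * \<i>))" for \<theta>
    proof -
      have "of_real (F \<theta>) * cis \<theta> ^ \<nu>
          = (\<Sum>k = - int \<nu>..int \<nu>. f k * exp (of_int k * of_real \<theta> * \<i>)) * cis \<theta> ^ \<nu>"
        using P(1) poly_eq_sum[of P "2 * \<nu>" "cis \<theta>"]
        unfolding half_trig_def cis_half_power2 fourier by (simp add: f_def)
      then show ?thesis unfolding mult_cancel_right by simp
    qed
    ultimately show "has_trig_degree F \<nu>"
      unfolding has_trig_degree_def by blast
  qed
qed

lemma has_trig_degree_unique:
  assumes "has_trig_degree F m" "has_trig_degree F n"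
  shows "m = n"
proof -
  have "\<not> m < n" if degs: "has_trig_degree F m" "has_trig_degree F n" for m n
  proof
    assume "m < n"
    obtain P Q where P: "half_trig (2 * m) F P" "coeff P (2 * m) \<noteq> 0"
      and Q: "half_trig (2 * n) F Q" "coeff Q (2 * n) \<noteq> 0"
      using degs unfolding has_trig_degree_iff by blast
    \<comment> \<open>The coefficient of \<open>Q\<close> at \<open>2 * n\<close> is that of
      \<open>P\<close> at \<open>n + m\<close>, which lies beyond the formal degree
      \<open>2 * m\<close>.\<close>
    have "Q = monom 1 (n - m) * P"
      using half_trig_unique[OF Q(1) half_trig_raise_le[OF P(1)]] \<open>m < n\<close> by simp
    moreover have "coeff P (n + m) = 0"
      using P(1) \<open>m < n\<close> by (intro coeff_eq_0) (auto simp: half_trig_def)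
    moreover have "2 * n - (n - m) = n + m" using \<open>m < n\<close> by simp
    ultimately show False using Q(2) by (simp add: coeff_monom_mult split: if_splits)
  qed
  then show ?thesis using assms by (metis nat_neq_iff)
qed

lemma trig_deg_eqI:
  assumes "half_trig (2 * n) F P" "coeff P (2 * n) \<noteq> 0"
  shows "trig_deg F = n"
proof -
  have "has_trig_degree F n" using assms has_trig_degree_iff by blast
  moreover have "F \<noteq> (\<lambda>_. 0)"
    using assms half_trig_eq_0_iff[OF assms(1)] by auto
  ultimately show ?thesis
    unfolding trig_deg_def using has_trig_degree_unique by (metis (mono_tags, lifting) the_equality)
qed

text \<open>Descent: if the coefficient at \<open>2 * n\<close> vanishes, so does the constant one
  by self-reciprocity, and dividing by \<open>z\<close> lowers the formal degree by two.\<close>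

lemma half_trig_imp_trig_degree:
  assumes "half_trig (2 * n) F P" "F \<noteq> (\<lambda>_. 0)"
  obtains \<nu> Q where "\<nu> \<le> n" "half_trig (2 * \<nu>) F Q" "coeff Q (2 * \<nu>) \<noteq> 0"
  using assms
proof (induction n arbitrary: P thesis)
  case 0
  then have "P \<noteq> 0" using half_trig_eq_0_iff by blast
  moreover have "degree P = 0" using 0 by (auto simp: half_trig_def)
  ultimately have "coeff P 0 \<noteq> 0" by (metis leading_coeff_0_iff)
  then show ?case using 0(1)[of 0 P] 0(2) by simp
next
  case (Suc n)
  show ?case
  proof (cases "coeff P (2 * Suc n) = 0")
    case False
    then show ?thesis using Suc.prems(1,2) by blast
  next
    case True
    then have "coeff P 0 = 0" using half_trig_coeff[OF Suc.prems(2), of 0] by simp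
    then obtain R where R: "P = [:0, 1:] * R"
      by (metis dvdE dvd_iff_poly_eq_0 minus_zero poly_0_coeff_0)
    have "P \<noteq> 0" using Suc.prems(2,3) half_trig_eq_0_iff by blast
    then have "degree P \<noteq> 2 * Suc n" using True by (metis leading_coeff_0_iff)
    moreover have "degree P \<le> 2 * Suc n" using Suc.prems(2) by (simp add: half_trig_def)
    moreover have "degree P = Suc (degree R)" using R \<open>P \<noteq> 0\<close> by (simp add: degree_mult_eq)
    ultimately have "degree R \<le> 2 * n" by simp
    moreover have "of_real (F \<theta>) * cis (\<theta> / 2) ^ (2 * n) = poly R (cis \<theta>)" for \<theta>
    proof -
      have "cis \<theta> * (of_real (F \<theta>) * cis \<theta> ^ n) = cis \<theta> * poly R (cis \<theta>)"
      proof -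
        have "of_real (F \<theta>) * cis (\<theta> / 2) ^ (2 * Suc n) = poly P (cis \<theta>)"
          using Suc.prems(2) unfolding half_trig_def by blast
        then show ?thesis unfolding cis_half_power2 R by (simp add: mult_ac)
      qed
      then show ?thesis by (simp add: cis_half_power2)
    qed
    ultimately have "half_trig (2 * n) F R" by (simp add: half_trig_def)
    from Suc.IH[OF _ this Suc.prems(3)] Suc.prems(1) show ?thesis
      by (metis le_SucI)
  qed
qed

lemma trig_deg_le: "half_trig (2 * n) F P \<Longrightarrow> trig_deg F \<le> n"
  by (metis half_trig_imp_trig_degree trig_deg_eqI trig_deg_def zero_le)

lemma half_trig_of_trig_deg_le:
  assumes "F \<in> trig_polys" "trig_deg F \<le> n"
  obtains P where "half_trig (2 * n) F P"
proof (cases "F = (\<lambda>_. 0)")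
  case True
  then show ?thesis using that half_trig_0 by blast
next
  case False
  obtain m Q where "half_trig (2 * m) F Q" by (rule trig_polys_imp_half_trig[OF assms(1)])
  then obtain \<nu> P where "half_trig (2 * \<nu>) F P" "coeff P (2 * \<nu>) \<noteq> 0"
    using half_trig_imp_trig_degree[OF _ False] by blast
  then show ?thesis
    using that half_trig_raise_le[of \<nu> F P n] trig_deg_eqI assms(2) by blast
qed

text \<open>A vanishing Wronskian makes the quotient constant. As \<open>M\<close> may have zeros,
  the quotient is not differentiated; \<open>c\<close> is its value at one point, and the order of
  vanishing there shows that \<open>N - c * M\<close> is zero.\<close>

lemma half_trig_const_ratio:
  assumes N: "half_trig n N P" and M: "half_trig n M Q" and "M \<noteq> (\<lambda>_. 0)"
    and eq: "\<And>\<theta>. deriv N \<theta> * M \<theta> = N \<theta> * deriv M \<theta>"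
  obtains c where "\<And>\<theta>. N \<theta> = c * M \<theta>"
proof -
  obtain \<theta>\<^sub>0 where \<theta>\<^sub>0: "M \<theta>\<^sub>0 \<noteq> 0" using assms(3) by auto
  define c where "c = N \<theta>\<^sub>0 / M \<theta>\<^sub>0"
  define R where "R = P - smult (of_real c) Q"
  have R: "half_trig n (\<lambda>\<theta>. N \<theta> - c * M \<theta>) R"
    unfolding R_def by (intro half_trig_diff half_trig_cmult assms)
  \<comment> \<open>\<open>?D\<close> is the derivative on the polynomial side; its term with
    \<open>n / 2\<close> cancels in the antisymmetric combination.\<close>
  let ?D = "\<lambda>P. smult \<i> (monom 1 1 * pderiv P - smult (of_nat n / 2) P)"
  have "?D P * Q = P * ?D Q"
    using half_trig_unique[OF half_trig_mult[OF half_trig_deriv(2)[OF N] M]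
        half_trig_mult[OF N half_trig_deriv(2)[OF M], folded eq]] .
  moreover have "?D P * Q - P * ?D Q = smult \<i> (monom 1 1 * (pderiv P * Q - P * pderiv Q))"
    by (simp add: algebra_simps smult_diff_right)
  ultimately have "pderiv P * Q = P * pderiv Q" by (simp add: monom_eq_0_iff)
  then have wronskian: "pderiv R * Q = R * pderiv Q"
    by (simp add: R_def pderiv_diff pderiv_smult algebra_simps)
  have Q0: "poly Q (cis \<theta>\<^sub>0) \<noteq> 0" and R0: "poly R (cis \<theta>\<^sub>0) = 0"
    using M R \<theta>\<^sub>0 unfolding half_trig_def c_def
    by (metis cis_neq_zero mult_eq_0_iff of_real_eq_0_iff power_not_zero,
        metis diff_self mult_zero_left nonzero_eq_divide_eq of_real_0)
  have "R = 0"
  proof (rule ccontr)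
    assume "R \<noteq> 0"
    let ?z = "cis \<theta>\<^sub>0"
    have "pderiv R \<noteq> 0"
    proof
      assume "pderiv R = 0"
      then have "degree R = 0" by (simp add: pderiv_eq_0_iff)
      then obtain a where "R = [:a:]" by (rule degree_eq_zeroE)
      then show False using R0 \<open>R \<noteq> 0\<close> by simp
    qed
    \<comment> \<open>As \<open>Q\<close> is nonzero at \<open>?z\<close>, the identity bounds the
      order of \<open>R\<close> by that of \<open>pderiv R\<close>, which is smaller by one.\<close>
    then have "order ?z (pderiv R * Q) = order ?z (pderiv R)"
      using Q0 by (subst order_mult) (auto simp: order_0I)
    moreover have "pderiv R * Q \<noteq> 0" using \<open>pderiv R \<noteq> 0\<close> Q0 by auto
    then have "order ?z R \<le> order ?z (pderiv R * Q)"
      unfolding wronskian by (subst order_mult) auto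
    ultimately show False
      using order_pderiv[OF \<open>R \<noteq> 0\<close> R0] by simp
  qed
  then have "N \<theta> = c * M \<theta>" for \<theta>
    using half_trig_eq_0_iff[OF R] by (simp add: fun_eq_iff)
  then show ?thesis using that by blast
qed

section \<open>Pencils of self-reciprocal polynomials\<close>

text \<open>The sign makes this the numerator of the derivative of \<open>p / q\<close>.\<close>

definition wronskian :: "complex poly \<Rightarrow> complex poly \<Rightarrow> complex poly" where
  "wronskian p q = q * pderiv p - p * pderiv q"

lemma wronskian_lincomb:
  "wronskian (smult a p + smult b q) (smult c p + smult d q) = smult (a * d - b * c) (wronskian p q)"
  by (simp add: wronskian_def pderiv_add pderiv_smult algebra_simps smult_add_right
      smult_diff_right smult_diff_left mult.commute)

lemma degree_wronskian_le: "degree (wronskian p q) \<le> degree p + degree q - 1"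
proof -
  have "degree (g * pderiv f) \<le> degree f + degree g - 1" for f g :: "complex poly"
  proof (cases "pderiv f = 0")
    case False
    then have "degree f \<noteq> 0" by (simp add: pderiv_eq_0_iff)
    then show ?thesis using degree_mult_le[of g "pderiv f"] by (simp add: degree_pderiv)
  qed simp
  from this[of q p] this[of p q] show ?thesis
    unfolding wronskian_def by (intro degree_diff_le) (simp_all add: add.commute)
qed

text \<open>Subtracting a multiple of \<open>p\<close> from \<open>q\<close> cancels the leading
  term of \<open>q\<close> without changing the Wronskian.\<close>

lemma degree_wronskian_same_degree_le:
  assumes "degree p = degree q"
  shows "degree (wronskian p q) \<le> 2 * degree p - 2"
proof (cases "degree p = 0")
  case True
  then show ?thesis using degree_wronskian_le[of p q] assms by simp
next
  case False
  then have "p \<noteq> 0" by auto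
  define c where "c = lead_coeff q / lead_coeff p"
  define f where "f = smult (- c) p + smult 1 q"
  have "coeff f (degree p) = 0"
    using \<open>p \<noteq> 0\<close> by (simp add: f_def c_def assms[symmetric])
  moreover have "degree f \<le> degree p"
    unfolding f_def using assms by (intro degree_add_le order_trans[OF degree_smult_le]) auto
  ultimately have "coeff f i = 0" if "degree p - 1 < i" for i
    using that by (cases "i = degree p") (auto simp: coeff_eq_0)
  then have "degree f \<le> degree p - 1" by (intro degree_le) blast
  moreover have "wronskian p f = wronskian p q"
    using wronskian_lincomb[of 1 p 0 q "-c" 1] by (simp add: f_def)
  ultimately show ?thesis using degree_wronskian_le[of p f] by simp
qed

text \<open>A root of order \<open>k\<close> of \<open>p\<close> is one of order
  \<open>k - 1\<close> of \<open>pderiv p\<close>, so that power divides both terms.\<close>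

lemma order_wronskian_ge:
  assumes "p \<noteq> 0" "wronskian p q \<noteq> 0"
  shows "order x p - 1 \<le> order x (wronskian p q)"
proof (cases "order x p = 0")
  case False
  then have "poly p x = 0" using order_root by blast
  then have "order x p - 1 = order x (pderiv p)"
    using order_pderiv[OF assms(1)] by simp
  then have "[:-x, 1:] ^ (order x p - 1) dvd pderiv p" using order_1 by metis
  moreover have "[:-x, 1:] ^ (order x p - 1) dvd p" using order_divides by fastforce
  ultimately have "[:-x, 1:] ^ (order x p - 1) dvd wronskian p q"
    unfolding wronskian_def by (intro dvd_diff dvd_mult2 dvd_mult)
  then show ?thesis using order_divides assms(2) by blast
qed simp

text \<open>The number of roots in \<open>\<complex> - {0}\<close>, with multiplicity.\<close>

definition nz_roots :: "complex poly \<Rightarrow> nat" where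
  "nz_roots f = degree f - order 0 f"

lemma nz_roots_mult:
  assumes "f \<noteq> 0" "g \<noteq> 0"
  shows "nz_roots (f * g) = nz_roots f + nz_roots g"
  using assms order_degree[of f 0] order_degree[of g 0] order_mult[of f g 0]
  by (simp add: nz_roots_def degree_mult_eq)

lemma nz_roots_prod:
  "(\<And>k. k \<in> K \<Longrightarrow> f k \<noteq> 0) \<Longrightarrow> nz_roots (\<Prod>k\<in>K. f k) = (\<Sum>k\<in>K. nz_roots (f k))"
proof (induction K rule: infinite_finite_induct)
  case (insert k K)
  then show ?case by (simp add: nz_roots_mult)
qed (simp_all add: nz_roots_def)

text \<open>The reflection of \<open>j\<close> to \<open>r - j\<close> exchanges the lowest and the
  highest nonzero coefficient.\<close>

lemma degree_plus_order_self_reciprocal: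
  assumes "f \<noteq> 0" "degree f \<le> r" "u \<noteq> 0" "conj_reflect r f = smult u f"
  shows "degree f + order 0 f = r"
proof -
  have refl: "cnj (coeff f (r - j)) = u * coeff f j" if "j \<le> r" for j
    using arg_cong[OF assms(4), of "\<lambda>g. coeff g j"] that by (simp add: coeff_conj_reflect)
  have low: "coeff f j = 0" if "j < order 0 f" for j
    using monom_1_dvd_iff[OF assms(1), of "order 0 f"] monom_1_dvd_iff'[of "order 0 f" f] that by simp
  have "order 0 f \<le> r" using order_degree[OF assms(1), of 0] assms(2) by simp
  have "coeff f (order 0 f) \<noteq> 0"
  proof
    assume "coeff f (order 0 f) = 0"
    then have "monom 1 (Suc (order 0 f)) dvd f"
      using low by (auto simp: monom_1_dvd_iff' less_Suc_eq)
    then show False using monom_1_dvd_iff[OF assms(1)] by auto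
  qed
  then have "coeff f (r - order 0 f) \<noteq> 0"
    using refl[OF \<open>order 0 f \<le> r\<close>] assms(3) by auto
  then have "r - order 0 f \<le> degree f" by (rule le_degree)
  moreover have "degree f \<le> r - order 0 f"
  proof (rule degree_le, intro allI impI)
    fix i assume i: "r - order 0 f < i"
    show "coeff f i = 0"
    proof (cases "i \<le> r")
      case True
      then have "r - i < order 0 f" using i \<open>order 0 f \<le> r\<close> by simp
      then show ?thesis using low refl[of "r - i"] True by simp
    qed (use assms(2) in \<open>simp add: coeff_eq_0\<close>)
  qed
  ultimately show ?thesis using \<open>order 0 f \<le> r\<close> by simp
qed

lemma nz_roots_self_reciprocal:
  assumes "f \<noteq> 0" "degree f \<le> r" "u \<noteq> 0" "conj_reflect r f = smult u f"
  shows "nz_roots f + 2 * order 0 f = r"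
  using degree_plus_order_self_reciprocal[OF assms] order_degree[OF assms(1), of 0]
  by (simp add: nz_roots_def)

text \<open>\<open>conj_reflect\<close> is conjugate-linear, hence the real coefficients: one
  \<open>u\<close> then serves the whole real pencil.\<close>

lemma conj_reflect_lincomb:
  assumes "conj_reflect r p = smult u p" "conj_reflect r q = smult u q"
  shows "conj_reflect r (smult (of_real a) p + smult (of_real b) q)
    = smult u (smult (of_real a) p + smult (of_real b) q)"
proof (rule poly_eqI)
  fix j
  have "coeff (conj_reflect r (smult (of_real a) p + smult (of_real b) q)) j
      = of_real a * coeff (conj_reflect r p) j + of_real b * coeff (conj_reflect r q) j"
    by (simp add: coeff_conj_reflect)
  then show "coeff (conj_reflect r (smult (of_real a) p + smult (of_real b) q)) j
      = coeff (smult u (smult (of_real a) p + smult (of_real b) q)) j"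
    by (simp add: assms algebra_simps)
qed

text \<open>By Cramer's rule, \<open>p\<close> and \<open>q\<close> are, up to the nonzero
  determinant, combinations of the two new polynomials.\<close>

lemma coprime_lincomb:
  fixes p q :: "complex poly"
  assumes "coprime p q" "a * d - b * c \<noteq> 0"
  shows "coprime (smult a p + smult b q) (smult c p + smult d q)"
proof (rule coprimeI)
  fix g assume g: "g dvd smult a p + smult b q" "g dvd smult c p + smult d q"
  have "g dvd smult d (smult a p + smult b q) - smult b (smult c p + smult d q)"
    using g by (intro dvd_diff dvd_smult)
  also have "\<dots> = smult (a * d - b * c) p"
    by (simp add: smult_add_right smult_diff_left algebra_simps)
  finally have p: "g dvd p" using assms(2) dvd_smult_iff by blast
  have "g dvd smult a (smult c p + smult d q) - smult c (smult a p + smult b q)"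
    using g by (intro dvd_diff dvd_smult)
  also have "\<dots> = smult (a * d - b * c) q"
    by (simp add: smult_add_right smult_diff_left algebra_simps)
  finally have "g dvd q" using assms(2) dvd_smult_iff by blast
  with p assms(1) show "is_unit g" using coprime_common_divisor by blast
qed

text \<open>Compares the numbers of nonzero roots on both sides of \<open>eq\<close>:
  \<open>monom c e\<close> has none and \<open>a\<close> at most \<open>2 * \<eta>\<close>. The
  terms of the maximum belong to the cases that no member, or exactly one member, of the family
  vanishes at \<open>0\<close>.\<close>

lemma pencil_card_le:
  fixes p q a H :: "complex poly" and \<alpha> \<beta> :: "'k \<Rightarrow> real"
  defines "l k \<equiv> smult (of_real (\<alpha> k)) p + smult (of_real (\<beta> k)) q"
  assumes K: "finite K" "card K \<ge> 2"
    and coprime: "coprime p q" and deg: "degree p \<le> r" "degree q \<le> r"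
    and refl: "u \<noteq> 0" "conj_reflect r p = smult u p" "conj_reflect r q = smult u q"
    and det: "\<And>j k. j \<in> K \<Longrightarrow> k \<in> K \<Longrightarrow> j \<noteq> k \<Longrightarrow> \<alpha> j * \<beta> k - \<beta> j * \<alpha> k \<noteq> 0"
    and a: "degree a \<le> 2 * \<eta>"
    and eq: "a * (monom c e * wronskian p q) = H * (\<Prod>k\<in>K. l k)"
    and nonzero: "H \<noteq> 0" "c \<noteq> 0" "wronskian p q \<noteq> 0"
  shows "card K \<le> max (2 * \<eta>) (\<eta> + 2)"
proof -
  obtain t where t: "card K = t + 2" using K(2) by (metis add.commute le_Suc_ex)
  define s where "s k = order 0 (l k)" for k
  have wr: "wronskian (l j) (l k) = smult (of_real (\<alpha> j * \<beta> k - \<beta> j * \<alpha> k)) (wronskian p q)" for j k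
    unfolding l_def wronskian_lincomb by simp
  have other: "\<exists>j\<in>K. j \<noteq> k" for k
  proof (rule ccontr)
    assume "\<not> ?thesis"
    then have "K \<subseteq> {k}" by blast
    then have "card K \<le> card {k}" by (intro card_mono) auto
    then show False using K(2) by simp
  qed
  have wr0: "wronskian (l j) (l k) \<noteq> 0" if "j \<in> K" "k \<in> K" "j \<noteq> k" for j k
    using wr[of j k] det[OF that] nonzero(3) by (metis of_real_eq_0_iff smult_eq_0_iff)
  have l0: "l k \<noteq> 0" if "k \<in> K" for k
  proof
    assume "l k = 0"
    moreover obtain j where "j \<in> K" "j \<noteq> k" using other by blast
    ultimately show False using wr0[OF \<open>j \<in> K\<close> \<open>k \<in> K\<close>] by (simp add: wronskian_def)
  qed
  have deg_l: "degree (l k) \<le> r" for k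
    unfolding l_def using deg by (intro degree_add_le order_trans[OF degree_smult_le])
  have nz_l: "nz_roots (l k) + 2 * s k = r" "degree (l k) + s k = r" if "k \<in> K" for k
    unfolding s_def
    using nz_roots_self_reciprocal[OF l0[OF that] deg_l refl(1)]
      degree_plus_order_self_reciprocal[OF l0[OF that] deg_l refl(1)]
      conj_reflect_lincomb[OF refl(2,3)] l_def by auto
  have "(\<Prod>k\<in>K. l k) \<noteq> 0" using l0 K by simp
  then have "a \<noteq> 0" using eq nonzero by auto
  have "nz_roots (a * (monom c e * wronskian p q)) = nz_roots a + nz_roots (wronskian p q)"
    using \<open>a \<noteq> 0\<close> nonzero
    by (simp add: nz_roots_mult monom_eq_0_iff) (simp add: nz_roots_def degree_monom_eq)
  moreover have "nz_roots (H * (\<Prod>k\<in>K. l k)) = nz_roots H + (\<Sum>k\<in>K. nz_roots (l k))"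
    using \<open>(\<Prod>k\<in>K. l k) \<noteq> 0\<close> nonzero l0 by (simp add: nz_roots_mult nz_roots_prod)
  moreover have "nz_roots a \<le> 2 * \<eta>" using a by (simp add: nz_roots_def)
  ultimately have count: "(\<Sum>k\<in>K. nz_roots (l k)) \<le> 2 * \<eta> + nz_roots (wronskian p q)"
    using eq by simp
  \<comment> \<open>Up to a constant the Wronskian is that of any two members, which can be chosen
    to suit the case at hand.\<close>
  have nz_w: "nz_roots (wronskian p q) = nz_roots (wronskian (l j) (l k))"
    if "j \<in> K" "k \<in> K" "j \<noteq> k" for j k
    using det[OF that] nonzero(3) unfolding wr nz_roots_def
    by (metis degree_smult_eq of_real_eq_0_iff order_smult)
  show ?thesis
  proof (cases "\<exists>k\<in>K. s k > 0")
    case False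
    \<comment> \<open>Now every member has degree exactly \<open>r\<close>, so the sharper degree
      bound for the Wronskian applies.\<close>
    obtain j k where jk: "j \<in> K" "k \<in> K" "j \<noteq> k" using other by metis
    have "(\<Sum>k\<in>K. nz_roots (l k)) = (t + 2) * r"
      using nz_l False by (simp add: t)
    moreover have "nz_roots (wronskian p q) \<le> 2 * r - 2"
      using degree_wronskian_same_degree_le[of "l j" "l k"] nz_l(2) jk False
      unfolding nz_w[OF jk] by (simp add: nz_roots_def)
    moreover have "r \<noteq> 0"
    proof
      assume "r = 0"
      then have "degree p = 0" "degree q = 0" using deg by auto
      then show False using nonzero(3) by (simp add: wronskian_def pderiv_eq_0_iff[THEN iffD2])
    qed
    ultimately have "t * r + 2 * r \<le> 2 * \<eta> + (2 * r - 2)" "r \<ge> 1"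
      using count by (auto simp: distrib_right)
    moreover have "t \<le> t * r" using \<open>r \<ge> 1\<close> by simp
    ultimately have "t + 2 \<le> 2 * \<eta>" by linarith
    then show ?thesis by (simp add: t)
  next
    case True
    then obtain k where k: "k \<in> K" "s k > 0" by blast
    \<comment> \<open>Two members vanishing at \<open>0\<close> would not be coprime.\<close>
    have s0: "s j = 0" if "j \<in> K" "j \<noteq> k" for j
    proof (rule ccontr)
      assume "s j \<noteq> 0"
      then have "poly (l j) 0 = 0" "poly (l k) 0 = 0"
        using k by (simp_all add: s_def order_root)
      moreover have "coprime (l j) (l k)"
        unfolding l_def using det[OF that(1) k(1) that(2)]
        by (intro coprime_lincomb[OF coprime]) (metis of_real_diff of_real_eq_0_iff of_real_mult)
      ultimately show False using coprime_poly_0 by blast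
    qed
    obtain j where j: "j \<in> K" "j \<noteq> k" using other by blast
    have "(\<Sum>k\<in>K. nz_roots (l k)) = nz_roots (l k) + (\<Sum>k\<in>K-{k}. nz_roots (l k))"
      using K k by (simp add: sum.remove)
    also have "(\<Sum>j\<in>K-{k}. nz_roots (l j)) = (\<Sum>j\<in>K-{k}. r)"
      using nz_l(1) s0 by (intro sum.cong) force+
    also have "\<dots> = (t + 1) * r"
      using k K(1) t by (simp add: card_Diff_singleton)
    finally have sum: "(\<Sum>k\<in>K. nz_roots (l k)) = (r - 2 * s k) + (t + 1) * r"
      using nz_l(1)[OF k(1)] by simp
    \<comment> \<open>The degree is at most \<open>2 * r - s k - 1\<close>, while \<open>0\<close>
      is a root of order at least \<open>s k - 1\<close>; this leaves at most
      \<open>2 * r - 2 * s k\<close> nonzero roots.\<close>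
    have "degree (wronskian (l k) (l j)) \<le> (r - s k) + r - 1"
      using degree_wronskian_le[of "l k" "l j"] nz_l(2)[OF k(1)] nz_l(2)[OF j(1)] s0[OF j] by simp
    moreover have "s k - 1 \<le> order 0 (wronskian (l k) (l j))"
      unfolding s_def using order_wronskian_ge l0 wr0 j k by metis
    moreover have "2 * s k \<le> r" using nz_l(1)[OF k(1)] by simp
    ultimately have "nz_roots (wronskian (l k) (l j)) \<le> 2 * r - 2 * s k"
      using k(2) unfolding nz_roots_def by linarith
    then have "nz_roots (wronskian p q) \<le> 2 * r - 2 * s k"
      using nz_w[OF k(1) j(1) j(2)[symmetric]] by simp
    then have "(r - 2 * s k) + (t + 1) * r \<le> 2 * \<eta> + (2 * r - 2 * s k)"
      using count sum by simp
    \<comment> \<open>Here \<open>r \<ge> 2\<close>, which turns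
      \<open>t * r \<le> 2 * \<eta>\<close> into \<open>t \<le> \<eta>\<close>.\<close>
    moreover have "t * 2 \<le> t * r"
      using \<open>2 * s k \<le> r\<close> k(2) by (intro mult_le_mono2) simp
    ultimately have "t + 2 \<le> \<eta> + 2" 
      using \<open>2 * s k \<le> r\<close> unfolding distrib_right by linarith
    then show ?thesis by (simp add: t)
  qed
qed

text \<open>\<open>P / Q = p / q\<close> is real on the circle, so reflection preserves it, and
  coprimality makes the reflections of \<open>p\<close> and \<open>q\<close> their multiples by a
  common \<open>U\<close>. One of the two has degree \<open>r\<close>, which forces \<open>U\<close>
  to be constant.\<close>

lemma reduced_pair_self_reciprocal:
  fixes p q P Q :: "complex poly"
  assumes "coprime p q" "P * q = Q * p" "degree P \<le> n" "degree Q \<le> n" "Q \<noteq> 0" "p \<noteq> 0"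
    and refl: "conj_reflect n P = P" "conj_reflect n Q = Q"
  defines "r \<equiv> max (degree p) (degree q)"
  obtains u where "u \<noteq> 0" "conj_reflect r p = smult u p" "conj_reflect r q = smult u q"
proof -
  have deg: "degree p \<le> r" "degree q \<le> r" by (simp_all add: r_def)
  have star: "P * conj_reflect r q = Q * conj_reflect r p"
  proof (rule poly_eq_on_circle)
    fix \<theta>
    have "poly P (cis \<theta>) * poly (conj_reflect r q) (cis \<theta>)
        = cis \<theta> ^ n * cis \<theta> ^ r * cnj (poly (P * q) (cis \<theta>))"
      using poly_conj_reflect[OF assms(3), of \<theta>] poly_conj_reflect[OF deg(2), of \<theta>] refl by simp
    also have "\<dots> = poly Q (cis \<theta>) * poly (conj_reflect r p) (cis \<theta>)"
      using poly_conj_reflect[OF assms(4), of \<theta>] poly_conj_reflect[OF deg(1), of \<theta>] refl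
      by (simp add: assms(2))
    finally show "poly (P * conj_reflect r q) (cis \<theta>) = poly (Q * conj_reflect r p) (cis \<theta>)"
      by simp
  qed
  have "Q * (p * conj_reflect r q) = (P * q) * conj_reflect r q"
    unfolding assms(2) by (simp only: mult.assoc)
  also have "\<dots> = q * (P * conj_reflect r q)" by (simp only: mult_ac)
  also have "\<dots> = Q * (q * conj_reflect r p)" unfolding star by (simp only: mult_ac)
  finally have eq: "p * conj_reflect r q = q * conj_reflect r p" using assms(5) by simp
  then have "p dvd q * conj_reflect r p" by (metis dvd_triv_left)
  then have "p dvd conj_reflect r p"
    using coprime_dvd_mult_right_iff[OF assms(1)] by blast
  then obtain U where U: "conj_reflect r p = p * U" by blast
  then have "p * conj_reflect r q = p * (q * U)" using eq by (simp add: mult_ac)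
  then have U': "conj_reflect r q = q * U" using assms(6) by simp
  have "conj_reflect r p \<noteq> 0"
  proof
    assume "conj_reflect r p = 0"
    then have "coeff (conj_reflect r p) (r - degree p) = 0" by simp
    then show False using deg(1) assms(6) by (simp add: coeff_conj_reflect)
  qed
  then have "U \<noteq> 0" using U by auto
  have "degree U = 0"
  proof (cases "degree p = r")
    case True
    then show ?thesis
      using degree_conj_reflect[of r p] U \<open>U \<noteq> 0\<close> assms(6) by (simp add: degree_mult_eq)
  next
    case False
    then have "degree q = r" "q \<noteq> 0" by (auto simp: r_def max_def split: if_splits)
    then show ?thesis
      using degree_conj_reflect[of r q] U' \<open>U \<noteq> 0\<close> by (simp add: degree_mult_eq)
  qed
  then obtain u where "U = [:u:]" by (rule degree_eq_zeroE)
  then show ?thesis using that[of u] U U' \<open>U \<noteq> 0\<close> by (simp add: mult.commute)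
qed

section \<open>Upper bound\<close>

lemma prod_dvd_of_pairwise_coprime:
  fixes f :: "'k \<Rightarrow> complex poly"
  assumes "finite K" "\<And>k. k \<in> K \<Longrightarrow> f k dvd g"
    "\<And>j k. j \<in> K \<Longrightarrow> k \<in> K \<Longrightarrow> j \<noteq> k \<Longrightarrow> coprime (f j) (f k)"
  shows "(\<Prod>k\<in>K. f k) dvd g"
  using assms
proof (induction K)
  case (insert k K)
  have "coprime (f k) (\<Prod>j\<in>K. f j)"
    using insert by (intro prod_coprime_right) auto
  then show ?case using insert by (simp add: divides_mult)
qed simp

lemma wronskian_mult_left: "wronskian (g * p) (g * q) = g * g * wronskian p q"
  by (simp add: wronskian_def pderiv_mult algebra_simps)

text \<open>Stated for finite sets of solutions, since finiteness of the whole solution set is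
  derived from this bound. Three solutions are needed to form \<open>p\<close> and
  \<open>q\<close>.\<close>

lemma card_finite_riccati_solutions_le:
  assumes eq: "riccati_eq \<eta> A B0 B1 B2" and "B2 \<noteq> (\<lambda>_. 0)"
    and K: "finite K" "K \<subseteq> riccati_solutions A B0 B1 B2" "card K \<ge> 3"
  shows "card K \<le> max (2 * \<eta>) (\<eta> + 2)"
proof -
  have "A \<in> trig_polys" "B2 \<in> trig_polys" "trig_deg A \<le> \<eta>" "trig_deg B2 \<le> \<eta>"
    using eq by (auto simp: riccati_eq_def)
  obtain a where a: "half_trig (2 * \<eta>) A a"
    using \<open>A \<in> trig_polys\<close> \<open>trig_deg A \<le> \<eta>\<close> by (rule half_trig_of_trig_deg_le)
  obtain b where b: "half_trig (2 * \<eta>) B2 b"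
    using \<open>B2 \<in> trig_polys\<close> \<open>trig_deg B2 \<le> \<eta>\<close> by (rule half_trig_of_trig_deg_le)
  have "\<exists>n P. half_trig (2 * n) Y P" if "Y \<in> K" for Y
  proof -
    have "Y \<in> trig_polys" using K(2) that by (auto simp: riccati_solutions_def)
    then show ?thesis by (rule trig_polys_imp_half_trig) blast
  qed
  then obtain n P0 where P0: "\<And>Y. Y \<in> K \<Longrightarrow> half_trig (2 * n Y) Y (P0 Y)" by metis
  \<comment> \<open>The sum serves as a common upper bound for the formal degrees of all solutions
    in \<open>K\<close>.\<close>
  define d where "d = (\<Sum>Y\<in>K. n Y)"
  have "\<exists>P. half_trig (2 * d) Y P" if "Y \<in> K" for Y
    using half_trig_raise_le[OF P0[OF that], of d] member_le_sum[OF that, of n] K(1)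
    by (auto simp: d_def)
  then obtain P1 where P1: "\<And>Y. Y \<in> K \<Longrightarrow> half_trig (2 * d) Y (P1 Y)" by metis
  obtain T where "T \<subseteq> K" "card T = 3" using K(3) by (metis obtain_subset_with_card_n)
  then obtain Y1 Y2 Y3 where Y: "Y1 \<in> K" "Y2 \<in> K" "Y3 \<in> K" "Y1 \<noteq> Y2" "Y1 \<noteq> Y3" "Y2 \<noteq> Y3"
    by (auto simp: card_3_iff)
  define y where "y Y \<theta> = Y \<theta> - Y1 \<theta>" for Y :: "real \<Rightarrow> real" and \<theta>
  define P where "P Y = P1 Y - P1 Y1" for Y
  have P: "half_trig (2 * d) (y Y) (P Y)" if "Y \<in> K" for Y
    unfolding y_def P_def using half_trig_diff[OF P1[OF that] P1[OF Y(1)]] .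
  have y0: "y Y \<noteq> (\<lambda>_. 0)" if "Y \<noteq> Y1" for Y
    using that by (auto simp: y_def fun_eq_iff)
  have y23: "(\<lambda>\<theta>. y Y2 \<theta> - y Y3 \<theta>) \<noteq> (\<lambda>_. 0)"
    using Y(6) by (auto simp: y_def fun_eq_iff)
  \<comment> \<open>Subtracting the particular solution \<open>Y1\<close> removes \<open>B0\<close>
    and leaves a Bernoulli equation for each \<open>y Y\<close>.\<close>
  define Bt where "Bt \<theta> = B1 \<theta> + 2 * B2 \<theta> * Y1 \<theta>" for \<theta>
  have ode: "A \<theta> * deriv (y Y) \<theta> = Bt \<theta> * y Y \<theta> + B2 \<theta> * (y Y \<theta>)\<^sup>2" if "Y \<in> K" for Y \<theta>
  proof -
    have "deriv (y Y) \<theta> = deriv Y \<theta> - deriv Y1 \<theta>"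
      unfolding y_def
      by (intro DERIV_imp_deriv DERIV_diff half_trig_deriv(1)[OF P1] that Y(1))
    then have "A \<theta> * deriv (y Y) \<theta> = A \<theta> * deriv Y \<theta> - A \<theta> * deriv Y1 \<theta>"
      by (simp add: right_diff_distrib)
    moreover have "A \<theta> * deriv Z \<theta> = B0 \<theta> + B1 \<theta> * Z \<theta> + B2 \<theta> * (Z \<theta>)\<^sup>2" if "Z \<in> K" for Z
      using K(2) that by (auto simp: riccati_solutions_def)
    note this[OF that] this[OF Y(1)]
    ultimately show ?thesis
      by (simp add: y_def Bt_def power2_eq_square algebra_simps)
  qed
  define D where "D P = smult \<i> (monom 1 1 * pderiv P - smult (of_nat (2 * d) / 2) P)" for P
  have D: "half_trig (2 * d) (deriv (y Y)) (D (P Y))" if "Y \<in> K" for Y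
    unfolding D_def by (rule half_trig_deriv(2)[OF P[OF that]])
  \<comment> \<open>Eliminates \<open>Bt\<close> between the equations for \<open>y Y2\<close> and
    \<open>y Y3\<close>.\<close>
  have main: "A \<theta> * (y Y3 \<theta> * deriv (y Y2) \<theta> - y Y2 \<theta> * deriv (y Y3) \<theta>)
      = B2 \<theta> * (y Y2 \<theta> * (y Y3 \<theta> * (y Y2 \<theta> - y Y3 \<theta>)))" for \<theta>
  proof -
    have "A \<theta> * (y Y3 \<theta> * deriv (y Y2) \<theta> - y Y2 \<theta> * deriv (y Y3) \<theta>)
        = y Y3 \<theta> * (A \<theta> * deriv (y Y2) \<theta>) - y Y2 \<theta> * (A \<theta> * deriv (y Y3) \<theta>)"
      by (simp add: algebra_simps)
    then show ?thesis
      by (simp add: ode Y power2_eq_square algebra_simps)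
  qed
  have rhs: "half_trig (2 * \<eta> + (2 * d + (2 * d + 2 * d)))
      (\<lambda>\<theta>. B2 \<theta> * (y Y2 \<theta> * (y Y3 \<theta> * (y Y2 \<theta> - y Y3 \<theta>))))
      (b * (P Y2 * (P Y3 * (P Y2 - P Y3))))"
    by (intro half_trig_mult half_trig_diff b P Y)
  \<comment> \<open>The left side is quadratic in the differences and the right side cubic; raising
    by \<open>2 * d\<close> aligns the formal degrees.\<close>
  have "half_trig (2 * \<eta> + (2 * d + 2 * d) + 2 * d)
      (\<lambda>\<theta>. A \<theta> * (y Y3 \<theta> * deriv (y Y2) \<theta> - y Y2 \<theta> * deriv (y Y3) \<theta>))
      (monom 1 d * (a * (P Y3 * D (P Y2) - P Y2 * D (P Y3))))"
    by (intro half_trig_raise half_trig_mult half_trig_diff a P D Y)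
  then have "monom 1 d * (a * (P Y3 * D (P Y2) - P Y2 * D (P Y3)))
      = b * (P Y2 * (P Y3 * (P Y2 - P Y3)))"
    using half_trig_unique[OF _ rhs] unfolding main by (simp add: add.assoc)
  moreover have "P Y3 * D (P Y2) - P Y2 * D (P Y3) = monom \<i> 1 * wronskian (P Y2) (P Y3)"
  proof -
    have D': "D Q = [:\<i>:] * (monom 1 1 * pderiv Q - [:of_nat (2 * d) / 2:] * Q)" for Q
      by (simp add: D_def)
    have "g * (u * (X * f' - k * f)) - f * (u * (X * g' - k * g)) = u * X * (g * f' - f * g')"
      for f g f' g' u X k :: "complex poly" by (simp add: algebra_simps)
    moreover have "monom \<i> 1 = [:\<i>:] * monom 1 1" by (simp add: smult_monom)
    ultimately show ?thesis unfolding D' wronskian_def by (simp only:)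
  qed
  moreover have "monom 1 d * (a * (monom \<i> 1 * w)) = a * (monom \<i> (d + 1) * w)" for w
  proof -
    have "monom \<i> (d + 1) = monom 1 d * monom \<i> 1" by (simp add: mult_monom)
    then show ?thesis by (simp only: mult_ac)
  qed
  ultimately have main_poly: "a * (monom \<i> (d + 1) * wronskian (P Y2) (P Y3))
      = b * (P Y2 * (P Y3 * (P Y2 - P Y3)))"
    by (simp only:)
  have P_eq_0: "P Y \<noteq> 0" if "Y \<in> K" "Y \<noteq> Y1" for Y
    using half_trig_eq_0_iff[OF P[OF that(1)]] y0[OF that(2)] by simp
  have nonzero: "b \<noteq> 0" "P Y2 \<noteq> 0" "P Y3 \<noteq> 0" "P Y2 - P Y3 \<noteq> 0"
    using half_trig_eq_0_iff[OF b] assms(2) P_eq_0 Y y23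
      half_trig_eq_0_iff[OF half_trig_diff[OF P[OF Y(2)] P[OF Y(3)]]] by simp_all
  then have "a \<noteq> 0" using main_poly by auto
  then have "A \<noteq> (\<lambda>_. 0)" using half_trig_eq_0_iff[OF a] by simp

  have "\<exists>c. \<forall>\<theta>. y Y \<theta> * ((1 - c) * y Y3 \<theta> + c * y Y2 \<theta>) = y Y2 \<theta> * y Y3 \<theta>"
    if YK: "Y \<in> K" "Y \<noteq> Y1" for Y
  proof -
    \<comment> \<open>\<open>?N / ?M\<close> is the cross ratio of the four solutions, and
      \<open>?N = c * ?M\<close> rearranges to the claim.\<close>
    let ?N = "\<lambda>\<theta>. y Y3 \<theta> * (y Y2 \<theta> - y Y \<theta>)" and ?M = "\<lambda>\<theta>. y Y \<theta> * (y Y2 \<theta> - y Y3 \<theta>)"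
    have N: "half_trig (2 * d + 2 * d) ?N (P Y3 * (P Y2 - P Y))"
      and M: "half_trig (2 * d + 2 * d) ?M (P Y * (P Y2 - P Y3))"
      by (intro half_trig_mult half_trig_diff P Y YK)+
    have "?M \<noteq> (\<lambda>_. 0)"
      using half_trig_mult_eq_0[OF P[OF YK(1)] half_trig_diff[OF P[OF Y(2)] P[OF Y(3)]]]
        y23 y0[OF YK(2)] by (metis (no_types, lifting))
    have dN: "deriv ?N \<theta> = deriv (y Y3) \<theta> * (y Y2 \<theta> - y Y \<theta>)
        + (deriv (y Y2) \<theta> - deriv (y Y) \<theta>) * y Y3 \<theta>" for \<theta>
      by (intro DERIV_imp_deriv DERIV_mult DERIV_diff half_trig_deriv(1)[OF P] Y YK)
    have dM: "deriv ?M \<theta> = deriv (y Y) \<theta> * (y Y2 \<theta> - y Y3 \<theta>)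
        + (deriv (y Y2) \<theta> - deriv (y Y3) \<theta>) * y Y \<theta>" for \<theta>
      by (intro DERIV_imp_deriv DERIV_mult DERIV_diff half_trig_deriv(1)[OF P] Y YK)
    have "A \<theta> * (deriv ?N \<theta> * ?M \<theta> - ?N \<theta> * deriv ?M \<theta>) = 0" for \<theta>
    proof -
      have "A \<theta> * (deriv ?N \<theta> * ?M \<theta> - ?N \<theta> * deriv ?M \<theta>)
        = ((A \<theta> * deriv (y Y3) \<theta>) * (y Y2 \<theta> - y Y \<theta>)
            + (A \<theta> * deriv (y Y2) \<theta> - A \<theta> * deriv (y Y) \<theta>) * y Y3 \<theta>) * ?M \<theta>
          - ?N \<theta> * ((A \<theta> * deriv (y Y) \<theta>) * (y Y2 \<theta> - y Y3 \<theta>)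
            + (A \<theta> * deriv (y Y2) \<theta> - A \<theta> * deriv (y Y3) \<theta>) * y Y \<theta>)"
        unfolding dN dM by (simp add: algebra_simps)
      also have "\<dots> = 0"
        unfolding ode[OF Y(2)] ode[OF Y(3)] ode[OF YK(1)] by algebra
      finally show ?thesis .
    qed
    then have "(\<lambda>\<theta>. deriv ?N \<theta> * ?M \<theta> - ?N \<theta> * deriv ?M \<theta>) = (\<lambda>_. 0)"
      using half_trig_mult_eq_0[OF a half_trig_diff[OF half_trig_mult[OF half_trig_deriv(2)[OF N] M]
            half_trig_mult[OF N half_trig_deriv(2)[OF M]]]] \<open>A \<noteq> (\<lambda>_. 0)\<close>
      by blast
    then have "deriv ?N \<theta> * ?M \<theta> = ?N \<theta> * deriv ?M \<theta>" for \<theta>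
      by (simp add: fun_eq_iff)
    from half_trig_const_ratio[OF N M \<open>?M \<noteq> (\<lambda>_. 0)\<close> this]
    obtain c where "\<And>\<theta>. ?N \<theta> = c * ?M \<theta>" by blast
    then show ?thesis by (intro exI[of _ c] allI) (simp add: algebra_simps)
  qed
  then obtain c where c: "\<And>Y \<theta>. Y \<in> K \<Longrightarrow> Y \<noteq> Y1 \<Longrightarrow>
      y Y \<theta> * ((1 - c Y) * y Y3 \<theta> + c Y * y Y2 \<theta>) = y Y2 \<theta> * y Y3 \<theta>"
    by metis
  have c_rep: "half_trig (2 * d) (\<lambda>\<theta>. (1 - c Y) * y Y3 \<theta> + c Y * y Y2 \<theta>)
      (smult (of_real (1 - c Y)) (P Y3) + smult (of_real (c Y)) (P Y2))" for Y
    by (intro half_trig_add half_trig_cmult P Y)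
  have c_inj: "c Y \<noteq> c Z" if "Y \<in> K" "Z \<in> K" "Y \<noteq> Y1" "Z \<noteq> Y1" "Y \<noteq> Z" for Y Z
  proof
    assume "c Y = c Z"
    then have "(y Y \<theta> - y Z \<theta>) * ((1 - c Y) * y Y3 \<theta> + c Y * y Y2 \<theta>) = 0" for \<theta>
      using c[of Y \<theta>] c[of Z \<theta>] that by (simp add: left_diff_distrib)
    moreover have "(\<lambda>\<theta>. (1 - c Y) * y Y3 \<theta> + c Y * y Y2 \<theta>) \<noteq> (\<lambda>_. 0)"
    proof
      assume "(\<lambda>\<theta>. (1 - c Y) * y Y3 \<theta> + c Y * y Y2 \<theta>) = (\<lambda>_. 0)"
      then have "y Y2 \<theta> * y Y3 \<theta> = 0" for \<theta>
        using c[of Y \<theta>] that by (metis mult_zero_right)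
      then show False
        using half_trig_mult_eq_0[OF P[OF Y(2)] P[OF Y(3)]] y0[of Y2] y0[of Y3] Y(4,5) by simp
    qed
    ultimately have "(\<lambda>\<theta>. y Y \<theta> - y Z \<theta>) = (\<lambda>_. 0)"
      using half_trig_mult_eq_0[OF half_trig_diff[OF P[OF that(1)] P[OF that(2)]] c_rep] by blast
    then show False using that(5) by (auto simp: y_def fun_eq_iff)
  qed

  define G where "G = gcd (P Y2) (P Y3)"
  have "G \<noteq> 0" using nonzero by (simp add: G_def)
  then obtain p q where pq: "P Y2 = G * p" "P Y3 = G * q" "coprime p q"
    using gcd_coprime_exists[of "P Y2" "P Y3"] unfolding G_def by (metis mult.commute)
  have main_pq: "a * (monom \<i> (d + 1) * wronskian p q) = b * (G * p * q) * (p - q)"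
  proof -
    have "(G * G) * (a * (monom \<i> (d + 1) * wronskian p q)) = (G * G) * (b * (G * p * q) * (p - q))"
      using main_poly unfolding pq wronskian_mult_left by (simp add: algebra_simps)
    then show ?thesis using \<open>G \<noteq> 0\<close> by simp
  qed
  have pq0: "p \<noteq> 0" "q \<noteq> 0" "p - q \<noteq> 0" using nonzero unfolding pq by auto

  \<comment> \<open>The values at \<open>Y1\<close> give \<open>l Y1 = p - q\<close>. By the
    defining equation \<open>c Y2 = 0\<close> and \<open>c Y3 = 1\<close>, so that
    \<open>l Y2 = q\<close> and \<open>l Y3 = p\<close>.\<close>
  define \<alpha> where "\<alpha> Y = (if Y = Y1 then 1 else c Y)" for Y
  define \<beta> where "\<beta> Y = (if Y = Y1 then - 1 else 1 - c Y)" for Y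
  define l where "l Y = smult (of_real (\<alpha> Y)) p + smult (of_real (\<beta> Y)) q" for Y
  \<comment> \<open>The determinant is \<open>c Y - c Z\<close> away from \<open>Y1\<close>, and
    \<open>1\<close> or \<open>- 1\<close> if \<open>Y1\<close> is involved.\<close>
  have det: "\<alpha> Y * \<beta> Z - \<beta> Y * \<alpha> Z \<noteq> 0" if "Y \<in> K" "Z \<in> K" "Y \<noteq> Z" for Y Z
    using c_inj[OF that(1,2) _ _ that(3)] that(3)
    by (auto simp: \<alpha>_def \<beta>_def algebra_simps)
  have dvd: "l Y dvd G * p * q" if YK: "Y \<in> K" "Y \<noteq> Y1" for Y
  proof -
    have "P Y * (smult (of_real (1 - c Y)) (P Y3) + smult (of_real (c Y)) (P Y2)) = P Y2 * P Y3"
      using half_trig_unique[OF half_trig_mult[OF P[OF YK(1)] c_rep, of Y, unfolded c[OF YK]]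
        half_trig_mult[OF P[OF Y(2)] P[OF Y(3)]]] .
    then have "G * (P Y * l Y) = G * (G * p * q)"
      using YK by (simp add: pq l_def \<alpha>_def \<beta>_def algebra_simps)
    then show ?thesis using \<open>G \<noteq> 0\<close> by (metis dvd_triv_right mult_left_cancel)
  qed
  have "(\<Prod>Y\<in>K-{Y1}. l Y) dvd G * p * q"
  proof (rule prod_dvd_of_pairwise_coprime)
    fix Y Z assume "Y \<in> K - {Y1}" "Z \<in> K - {Y1}" "Y \<noteq> Z"
    then have "complex_of_real (\<alpha> Y) * of_real (\<beta> Z) - of_real (\<beta> Y) * of_real (\<alpha> Z) \<noteq> 0"
      using det[of Y Z] by (metis DiffD1 of_real_diff of_real_eq_0_iff of_real_mult)
    then show "coprime (l Y) (l Z)"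
      unfolding l_def by (rule coprime_lincomb[OF pq(3)])
  qed (use K dvd in auto)
  then obtain H where H: "G * p * q = (\<Prod>Y\<in>K-{Y1}. l Y) * H" by blast
  have "l Y1 = p - q" by (simp add: l_def \<alpha>_def \<beta>_def)
  then have "(\<Prod>Y\<in>K. l Y) = (p - q) * (\<Prod>Y\<in>K-{Y1}. l Y)"
    using K Y by (simp add: prod.remove)
  then have final: "a * (monom \<i> (d + 1) * wronskian p q) = (b * H) * (\<Prod>Y\<in>K. l Y)"
    using main_pq H by (simp add: mult_ac)
  have "H \<noteq> 0" using H \<open>G \<noteq> 0\<close> pq0 by auto
  have "wronskian p q \<noteq> 0"
    using main_pq nonzero(1) \<open>G \<noteq> 0\<close> pq0 by auto
  obtain u where u: "u \<noteq> 0" "conj_reflect (max (degree p) (degree q)) p = smult u p"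
    "conj_reflect (max (degree p) (degree q)) q = smult u q"
  proof (rule reduced_pair_self_reciprocal[OF pq(3), of "P Y2" "P Y3" "2 * d"])
    show "P Y2 * q = P Y3 * p" by (simp add: pq mult_ac)
  qed (use P[OF Y(2)] P[OF Y(3)] nonzero pq0 half_trig_conj_reflect in \<open>auto simp: half_trig_def\<close>)
  show ?thesis
    by (rule pencil_card_le[OF K(1) _ pq(3) _ _ u(1,2,3) det _ final[unfolded l_def]])
      (use K a \<open>H \<noteq> 0\<close> \<open>wronskian p q \<noteq> 0\<close> nonzero in \<open>auto simp: half_trig_def\<close>)
qed

text \<open>A uniform bound on the finite subsets implies finiteness. The maximum of
  \<open>2 * \<eta>\<close> and \<open>\<eta> + 2\<close> is \<open>3\<close> for
  \<open>\<eta> = 1\<close> and \<open>2 * \<eta>\<close> otherwise.\<close>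

lemma riccati_solutions_bound:
  assumes "\<eta> \<ge> 1" "riccati_eq \<eta> A B0 B1 B2" "B2 \<noteq> (\<lambda>_. 0)"
  shows "finite (riccati_solutions A B0 B1 B2)"
    and "card (riccati_solutions A B0 B1 B2) \<le> (if \<eta> = 1 then 3 else 2 * \<eta>)"
proof -
  have *: "card K \<le> (if \<eta> = 1 then 3 else 2 * \<eta>)"
    if "K \<subseteq> riccati_solutions A B0 B1 B2" "finite K" for K
    using card_finite_riccati_solutions_le[OF assms(2,3) that(2,1)] assms(1)
    by (cases "card K \<ge> 3") auto
  show "finite (riccati_solutions A B0 B1 B2)"
    "card (riccati_solutions A B0 B1 B2) \<le> (if \<eta> = 1 then 3 else 2 * \<eta>)"
    using finite_if_finite_subsets_card_bdd[of _ "if \<eta> = 1 then 3 else 2 * \<eta>"] * by blast+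
qed

section \<open>Equations attaining each number of solutions\<close>

lemma trig_deg_const: "trig_deg (\<lambda>_. c) = 0"
  using trig_deg_le[of 0 "\<lambda>_. c"] half_trig_const[of c] by simp

lemma riccati_eqI:
  assumes "A \<in> trig_polys" "B0 \<in> trig_polys" "B1 \<in> trig_polys" "B2 \<in> trig_polys"
    and "trig_deg A \<le> \<eta>" "trig_deg B0 \<le> \<eta>" "trig_deg B1 \<le> \<eta>" "trig_deg B2 \<le> \<eta>"
    and "\<eta> \<in> {trig_deg A, trig_deg B0, trig_deg B1, trig_deg B2}"
  shows "riccati_eq \<eta> A B0 B1 B2"
proof -
  have "Max {trig_deg A, trig_deg B0, trig_deg B1, trig_deg B2} = \<eta>"
    using assms by (intro Max_eqI) auto
  then show ?thesis using assms by (simp add: riccati_eq_def)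
qed

lemma trig_deg_two_plus_cos:
  assumes "\<eta> \<ge> 1"
  shows "trig_deg (\<lambda>\<theta>. 2 + cos (real \<eta> * \<theta>)) = \<eta>"
proof -
  let ?P = "monom (1/2) (2 * \<eta>) + monom 2 \<eta> + monom (1/2) 0 :: complex poly"
  have "half_trig (2 * \<eta>) (\<lambda>\<theta>. 2 + cos (real \<eta> * \<theta>)) ?P"
    unfolding half_trig_def
  proof (intro conjI allI)
    fix \<theta>
    have "of_real (cos x) * cis x = 1/2 + cis x * cis x / 2" for x
      using cos_double_cos[of x] sin_double[of x]
      by (simp add: complex_eq_iff cis_mult power2_eq_square field_simps)
    from this[of "real \<eta> * \<theta>"]
    have "of_real (2 + cos (real \<eta> * \<theta>)) * cis (real \<eta> * \<theta>)
        = 1/2 + cis (real \<eta> * \<theta>) * cis (real \<eta> * \<theta>) / 2 + 2 * cis (real \<eta> * \<theta>)"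
      by (simp add: distrib_right)
    moreover have "cis \<theta> ^ \<eta> = cis (real \<eta> * \<theta>)" by (rule Complex.DeMoivre)
    moreover have "cis \<theta> ^ (2 * \<eta>) = cis \<theta> ^ \<eta> * cis \<theta> ^ \<eta>"
      by (simp only: mult_2 power_add)
    ultimately show "of_real (2 + cos (real \<eta> * \<theta>)) * cis (\<theta> / 2) ^ (2 * \<eta>) = poly ?P (cis \<theta>)"
      unfolding cis_half_power2 by (simp add: poly_monom)
  qed (auto intro!: degree_add_le order_trans[OF degree_monom_le])
  moreover have "coeff ?P (2 * \<eta>) \<noteq> 0" using assms by simp
  ultimately show ?thesis by (rule trig_deg_eqI)
qed

lemma trig_polys_two_plus_cos: "(\<lambda>\<theta>. 2 + cos (real \<eta> * \<theta>)) \<in> trig_polys"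
  using trig_polys_add trig_polys_const trig_polys_cos_sin_nat by blast

lemma two_plus_cos_pos: "2 + cos x > (0 :: real)"
  using cos_ge_minus_one[of x] by linarith

lemma trig_polys_periodic: "F \<in> trig_polys \<Longrightarrow> F (\<theta> + 2 * pi) = F \<theta>"
  by (auto simp: trig_polys_def)

lemma trig_polys_DERIV: "F \<in> trig_polys \<Longrightarrow> (F has_real_derivative deriv F \<theta>) (at \<theta>)"
  by (meson half_trig_deriv(1) trig_polys_imp_half_trig)

text \<open>A solution would be strictly increasing, contrary to its periodicity. The positive
  coefficient \<open>2 + cos (\<eta> * \<theta>)\<close> supplies the degree.\<close>

lemma riccati_no_solution:
  assumes "\<eta> \<ge> 1"
  shows "riccati_eq \<eta> (\<lambda>_. 1) (\<lambda>\<theta>. 2 + cos (real \<eta> * \<theta>)) (\<lambda>_. 0) (\<lambda>_. 1)"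
    and "riccati_solutions (\<lambda>_. 1) (\<lambda>\<theta>. 2 + cos (real \<eta> * \<theta>)) (\<lambda>_. 0) (\<lambda>_. 1) = {}"
proof -
  show "riccati_eq \<eta> (\<lambda>_. 1) (\<lambda>\<theta>. 2 + cos (real \<eta> * \<theta>)) (\<lambda>_. 0) (\<lambda>_. 1)"
    using assms
    by (intro riccati_eqI trig_polys_const trig_polys_two_plus_cos)
      (simp_all add: trig_deg_const trig_deg_two_plus_cos)
  have False if Y: "Y \<in> trig_polys" "\<And>\<theta>. deriv Y \<theta> = 2 + cos (real \<eta> * \<theta>) + (Y \<theta>)\<^sup>2" for Y
  proof -
    have "deriv Y \<theta> > 0" for \<theta>
      unfolding Y(2) using two_plus_cos_pos by (simp add: add_pos_nonneg)
    then have ex: "\<exists>y. (Y has_real_derivative y) (at \<theta>) \<and> 0 < y" for \<theta>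
      using trig_polys_DERIV[OF Y(1)] by blast
    have "Y 0 < Y (0 + 2 * pi)" by (rule DERIV_pos_imp_increasing[OF _ ex]) simp
    then show False by (simp only: trig_polys_periodic[OF Y(1)] less_irrefl)
  qed
  then show "riccati_solutions (\<lambda>_. 1) (\<lambda>\<theta>. 2 + cos (real \<eta> * \<theta>)) (\<lambda>_. 0) (\<lambda>_. 1) = {}"
    by (auto simp: riccati_solutions_def)
qed

text \<open>A solution is nondecreasing and periodic, hence constant, so its derivative vanishes and
  with it \<open>Y\<^sup>2\<close>.\<close>

lemma riccati_one_solution:
  assumes "\<eta> \<ge> 1"
  shows "riccati_eq \<eta> (\<lambda>_. 1) (\<lambda>_. 0) (\<lambda>_. 0) (\<lambda>\<theta>. 2 + cos (real \<eta> * \<theta>))"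
    and "riccati_solutions (\<lambda>_. 1) (\<lambda>_. 0) (\<lambda>_. 0) (\<lambda>\<theta>. 2 + cos (real \<eta> * \<theta>)) = {\<lambda>_. 0}"
proof -
  show "riccati_eq \<eta> (\<lambda>_. 1) (\<lambda>_. 0) (\<lambda>_. 0) (\<lambda>\<theta>. 2 + cos (real \<eta> * \<theta>))"
    using assms
    by (intro riccati_eqI trig_polys_const trig_polys_two_plus_cos)
      (simp_all add: trig_deg_const trig_deg_two_plus_cos)
  have "Y \<theta> = 0"
    if Y: "Y \<in> trig_polys" "\<And>\<theta>. deriv Y \<theta> = (2 + cos (real \<eta> * \<theta>)) * (Y \<theta>)\<^sup>2" for Y \<theta>
  proof -
    have "deriv Y \<theta> \<ge> 0" for \<theta>
      unfolding Y(2) using two_plus_cos_pos[of "real \<eta> * \<theta>"] by simp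
    then have ex: "\<exists>y. (Y has_real_derivative y) (at \<theta>) \<and> 0 \<le> y" for \<theta>
      using trig_polys_DERIV[OF Y(1)] by blast
    have mono: "Y s \<le> Y t" if "s \<le> t" for s t
      by (rule DERIV_nonneg_imp_nondecreasing[OF that ex])
    have const: "Y t = Y (\<theta> - pi)" if "\<theta> - pi \<le> t" "t \<le> \<theta> + pi" for t
      using mono[OF that(1)] mono[OF that(2)] trig_polys_periodic[OF Y(1), of "\<theta> - pi"]
      by (simp add: add.commute)
    have "((\<lambda>_. Y (\<theta> - pi)) has_real_derivative deriv Y \<theta>) (at \<theta>)"
    proof (rule has_field_derivative_transform_within_open[OF trig_polys_DERIV[OF Y(1)]])
      show "open {\<theta> - pi<..<\<theta> + pi}" "\<theta> \<in> {\<theta> - pi<..<\<theta> + pi}" by auto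
    qed (auto intro: const)
    then have "deriv Y \<theta> = 0" using DERIV_unique DERIV_const by blast
    then show ?thesis
      unfolding Y(2) using two_plus_cos_pos[of "real \<eta> * \<theta>"] by (metis less_irrefl mult_eq_0_iff power_not_zero)
  qed
  then show "riccati_solutions (\<lambda>_. 1) (\<lambda>_. 0) (\<lambda>_. 0) (\<lambda>\<theta>. 2 + cos (real \<eta> * \<theta>)) = {\<lambda>_. 0}"
    by (auto simp: riccati_solutions_def trig_polys_const fun_eq_iff)
qed

text \<open>The constants \<open>1\<close> and \<open>- 1\<close> and the function
  \<open>- cos\<close> are solutions; the upper bound for \<open>\<eta> = 1\<close> excludes
  others.\<close>

lemma riccati_three_solutions:
  shows "riccati_eq 1 sin (\<lambda>_. 1) (\<lambda>_. 0) (\<lambda>_. - 1)"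
    and "card (riccati_solutions sin (\<lambda>_. 1) (\<lambda>_. 0) (\<lambda>_. - 1)) = 3"
proof -
  have "half_trig (2 * 1) sin [:\<i>/2, 0, - \<i>/2:]"
    unfolding half_trig_def cis_half_power2
  proof (intro conjI allI)
    fix \<theta> :: real
    show "of_real (sin \<theta>) * cis \<theta> ^ 1 = poly [:\<i>/2, 0, - \<i>/2:] (cis \<theta>)"
      using sin_cos_squared_add3[of \<theta>] by (simp add: complex_eq_iff) (simp add: field_simps)
  qed simp
  then have "trig_deg sin = 1" by (rule trig_deg_eqI) (simp add: numeral_2_eq_2)
  then show eq: "riccati_eq 1 sin (\<lambda>_. 1) (\<lambda>_. 0) (\<lambda>_. - 1)"
    by (intro riccati_eqI trig_polys_const trig_polys_cos_sin) (simp_all add: trig_deg_const)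
  have "(\<lambda>\<theta>. - cos \<theta>) \<in> trig_polys"
    using trig_polys_cmult[OF trig_polys_cos_sin(1), of "-1"] by simp
  moreover have "deriv (\<lambda>\<theta>. - cos \<theta>) \<theta> = sin \<theta>" for \<theta> :: real
    by (rule DERIV_imp_deriv) (auto intro!: derivative_eq_intros)
  ultimately have "{\<lambda>_. 1, \<lambda>_. - 1, \<lambda>\<theta>. - cos \<theta>} \<subseteq> riccati_solutions sin (\<lambda>_. 1) (\<lambda>_. 0) (\<lambda>_. - 1)"
    by (auto simp: riccati_solutions_def trig_polys_const sin_squared_eq power2_eq_square[symmetric])
  moreover have "card {\<lambda>_. 1, \<lambda>_. - 1, \<lambda>\<theta>::real. - cos \<theta>} = 3"
  proof -
    have "(\<lambda>_. 1) \<noteq> (\<lambda>\<theta>::real. - cos \<theta>)" by (metis cos_zero one_neq_neg_one)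
    moreover have "(\<lambda>_. - 1) \<noteq> (\<lambda>\<theta>::real. - cos \<theta>)"
      by (metis cos_pi minus_minus one_neq_neg_one)
    moreover have "(\<lambda>_::real. 1) \<noteq> (\<lambda>_. - 1 :: real)" by (metis one_neq_neg_one)
    ultimately show ?thesis by simp
  qed
  moreover have "(\<lambda>_::real. - 1 :: real) \<noteq> (\<lambda>_. 0)" by (metis neg_equal_0_iff_equal zero_neq_one)
  then have "finite (riccati_solutions sin (\<lambda>_. 1) (\<lambda>_. 0) (\<lambda>_. - 1))"
    "card (riccati_solutions sin (\<lambda>_. 1) (\<lambda>_. 0) (\<lambda>_. - 1)) \<le> 3"
    using riccati_solutions_bound[OF _ eq] by auto
  ultimately show "card (riccati_solutions sin (\<lambda>_. 1) (\<lambda>_. 0) (\<lambda>_. - 1)) = 3"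
    by (metis card_mono le_antisym)
qed

text \<open>
  The substitution \<open>u = 1 / Y\<close> linearizes an equation with the solution \<open>0\<close>. The equation is chosen such
  that its nonzero solutions over the meromorphic functions are \<open>E / (C + c S)\<close> for constants \<open>c\<close>, where
  \<open>C = cos (\<theta>/2)\<close> and \<open>S = sin (\<theta>/2)\<close>. Such a quotient is a trigonometric polynomial iff \<open>C + c S\<close> is one of the
  linear factors of \<open>E\<close>; repeating one factor keeps the degree at \<open>\<eta>\<close> while lowering their number.
\<close>

lemma riccati_linear_factors:
  fixes \<eta> N :: nat
  assumes "2 \<le> N" "N \<le> 2 * \<eta>"
  shows "\<exists>A B1. riccati_eq \<eta> A (\<lambda>_. 0) B1 (\<lambda>_. 1) \<and>
    finite (riccati_solutions A (\<lambda>_. 0) B1 (\<lambda>_. 1)) \<and>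
    card (riccati_solutions A (\<lambda>_. 0) B1 (\<lambda>_. 1)) = N"
proof -
  \<comment> \<open>\<open>E\<close> gets \<open>2 * \<eta> - 1\<close> half-angle factors,
    \<open>N - 1\<close> of them distinct: \<open>L 0\<close> occurs \<open>e + 1\<close> times.
    Dropping one leaves an even number, which makes \<open>Y j\<close> a trigonometric
    polynomial.\<close>
  define e where "e = 2 * \<eta> - N"
  define S C where "S \<theta> = sin (\<theta> / 2)" and "C \<theta> = cos (\<theta> / 2)" for \<theta> :: real
  define L where "L c \<theta> = C \<theta> + c * S \<theta>" for c \<theta> :: real
  define E where "E \<theta> = L 0 \<theta> ^ e * (\<Prod>k<N-1. L (real k) \<theta>)" for \<theta>
  define Y where "Y j \<theta> = L 0 \<theta> ^ e * (\<Prod>k\<in>{..<N-1}-{j}. L (real k) \<theta>)" for j \<theta>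
  define SP CP :: "complex poly" where "SP = [:\<i> / 2, - \<i> / 2:]" and "CP = [:1 / 2, 1 / 2:]"
  define LP where "LP c = CP + smult (of_real c) SP" for c :: real
  define EP where "EP = LP 0 ^ e * (\<Prod>k<N-1. LP (real k))"
  define YP where "YP j = LP 0 ^ e * (\<Prod>k\<in>{..<N-1}-{j}. LP (real k))" for j

  have S: "half_trig 1 S SP" and C: "half_trig 1 C CP"
    unfolding S_def SP_def C_def CP_def by (fact half_trig_sin_half half_trig_cos_half)+
  have L: "half_trig 1 (L c) (LP c)" for c
    unfolding L_def LP_def by (intro half_trig_add half_trig_cmult S C)
  have LP: "degree (LP c) = 1" "LP c \<noteq> 0" for c
  proof -
    have "(1 - of_real c * \<i> :: complex) \<noteq> 0" by (simp add: complex_eq_iff)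
    then have "coeff (LP c) 1 \<noteq> 0" by (simp add: LP_def CP_def SP_def field_simps)
    then show "degree (LP c) = 1" "LP c \<noteq> 0"
      using L[of c] le_degree[of "LP c" 1] by (auto simp: half_trig_def)
  qed
  have E: "half_trig (2 * \<eta> - 1) E EP"
  proof -
    have "half_trig (e * 1 + (\<Sum>k<N-1. 1)) E EP"
      unfolding E_def EP_def by (intro half_trig_mult half_trig_power half_trig_prod L)
    moreover have "e * 1 + (\<Sum>k<N-1. 1) = 2 * \<eta> - 1" using assms by (simp add: e_def)
    ultimately show ?thesis by simp
  qed
  have EP: "degree EP = 2 * \<eta> - 1" "EP \<noteq> 0"
    using LP assms by (auto simp: EP_def e_def degree_mult_eq degree_power_eq degree_prod_eq_sum_degree)
  have Y: "half_trig (2 * (\<eta> - 1)) (Y j) (YP j)" if "j < N - 1" for j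
  proof -
    have "half_trig (e * 1 + (\<Sum>k\<in>{..<N-1}-{j}. 1)) (Y j) (YP j)"
      unfolding Y_def YP_def by (intro half_trig_mult half_trig_power half_trig_prod L)
    moreover have "e * 1 + (\<Sum>k\<in>{..<N-1}-{j}. 1) = 2 * (\<eta> - 1)"
      using assms that by (simp add: e_def)
    ultimately show ?thesis by simp
  qed
  have factor: "E \<theta> = Y j \<theta> * L (real j) \<theta>" if "j < N - 1" for j \<theta>
    using prod.remove[of "{..<N-1}" j "\<lambda>k. L (real k) \<theta>"] that by (simp add: E_def Y_def)
  have dS: "(S has_real_derivative C \<theta> / 2) (at \<theta>)"
    and dC: "(C has_real_derivative - S \<theta> / 2) (at \<theta>)" for \<theta>
    unfolding S_def C_def by (auto intro!: derivative_eq_intros)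
  have SC: "(S \<theta>)\<^sup>2 + (C \<theta>)\<^sup>2 = 1" for \<theta> by (simp add: S_def C_def)
  note dE = half_trig_deriv(1)[OF E]

  \<comment> \<open>These coefficients result from differentiating the first integral
    \<open>(E - C * Z) / (S * Z) = c\<close> and using
    \<open>S\<^sup>2 + C\<^sup>2 = 1\<close>.\<close>
  define A where "A \<theta> = 2 * (S \<theta> * E \<theta>)" for \<theta>
  define B1 where "B1 \<theta> = 2 * (S \<theta> * deriv E \<theta>) - C \<theta> * E \<theta>" for \<theta>
  have idx: "1 + (2 * \<eta> - 1) = 2 * \<eta>" using assms by simp
  have A: "half_trig (2 * \<eta>) A (smult (of_real 2) (SP * EP))"
    unfolding A_def using half_trig_cmult[OF half_trig_mult[OF S E], of 2] unfolding idx .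
  have B1: "\<exists>P. half_trig (2 * \<eta>) B1 P"
    unfolding B1_def
    using half_trig_diff[OF half_trig_cmult[OF half_trig_mult[OF S half_trig_deriv(2)[OF E]], of 2]
        half_trig_mult[OF C E]] unfolding idx by blast
  have SP: "SP \<noteq> 0" "degree SP = 1" by (simp_all add: SP_def)
  then have "degree (smult (of_real 2) (SP * EP)) = 2 * \<eta>"
    using EP idx by (simp add: degree_mult_eq)
  moreover have "smult (of_real 2) (SP * EP) \<noteq> 0" using EP(2) SP(1) by simp
  ultimately have "trig_deg A = \<eta>"
    using trig_deg_eqI[OF A] by (metis leading_coeff_0_iff)
  then have eq: "riccati_eq \<eta> A (\<lambda>_. 0) B1 (\<lambda>_. 1)"
    using A B1 by (intro riccati_eqI trig_polys_const)
      (auto simp: trig_deg_const intro: half_trig_imp_trig_polys trig_deg_le)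

  have sol: "Y j \<in> riccati_solutions A (\<lambda>_. 0) B1 (\<lambda>_. 1)" if j: "j < N - 1" for j
  proof -
    have "A \<theta> * deriv (Y j) \<theta> = B1 \<theta> * Y j \<theta> + (Y j \<theta>)\<^sup>2" for \<theta>
    proof -
      have "((\<lambda>\<theta>. Y j \<theta> * L (real j) \<theta>) has_real_derivative
          deriv (Y j) \<theta> * L (real j) \<theta> + (- S \<theta> / 2 + real j * (C \<theta> / 2)) * Y j \<theta>) (at \<theta>)"
        unfolding L_def by (intro DERIV_mult DERIV_add DERIV_cmult dS dC half_trig_deriv(1)[OF Y[OF j]])
      moreover have "E = (\<lambda>\<theta>. Y j \<theta> * L (real j) \<theta>)" using factor[OF j] by blast
      ultimately have dE: "deriv E \<theta> =
          deriv (Y j) \<theta> * L (real j) \<theta> + (- S \<theta> / 2 + real j * (C \<theta> / 2)) * Y j \<theta>"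
        by (intro DERIV_imp_deriv) (simp only:)
      have "2 * (S \<theta> * (Y j \<theta> * L (real j) \<theta>)) * deriv (Y j) \<theta>
        = (2 * (S \<theta> * (deriv (Y j) \<theta> * L (real j) \<theta> + (- S \<theta> / 2 + real j * (C \<theta> / 2)) * Y j \<theta>))
           - C \<theta> * (Y j \<theta> * L (real j) \<theta>)) * Y j \<theta> + ((S \<theta>)\<^sup>2 + (C \<theta>)\<^sup>2) * (Y j \<theta>)\<^sup>2"
        by (simp add: L_def power2_eq_square algebra_simps)
      then show ?thesis unfolding A_def B1_def dE factor[OF j] SC by simp
    qed
    then show ?thesis
      using half_trig_imp_trig_polys[OF Y[OF j]] by (auto simp: riccati_solutions_def)
  qed
  have zero: "(\<lambda>_. 0) \<in> riccati_solutions A (\<lambda>_. 0) B1 (\<lambda>_. 1)"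
    by (auto simp: riccati_solutions_def trig_polys_const)
  have "Z = (\<lambda>_. 0) \<or> (\<exists>j<N-1. Z = Y j)"
    if Z_sol: "Z \<in> riccati_solutions A (\<lambda>_. 0) B1 (\<lambda>_. 1)" for Z
  proof (cases "Z = (\<lambda>_. 0)")
    case False
    have "Z \<in> trig_polys" and ode: "A \<theta> * deriv Z \<theta> = B1 \<theta> * Z \<theta> + (Z \<theta>)\<^sup>2" for \<theta>
      using Z_sol by (auto simp: riccati_solutions_def)
    then obtain d ZP where Z: "half_trig (2 * d) Z ZP" by (metis trig_polys_imp_half_trig)
    have idx': "1 + 2 * d + 2 * (\<eta> - 1) = 2 * \<eta> - 1 + 2 * d" using assms by simp
    have CZ: "half_trig (2 * \<eta> - 1 + 2 * d) (\<lambda>\<theta>. C \<theta> * Z \<theta>) (monom 1 (\<eta> - 1) * (CP * ZP))"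
      using half_trig_raise[OF half_trig_mult[OF C Z], of "\<eta> - 1"] unfolding idx' .
    have SZ: "half_trig (2 * \<eta> - 1 + 2 * d) (\<lambda>\<theta>. S \<theta> * Z \<theta>) (monom 1 (\<eta> - 1) * (SP * ZP))"
      using half_trig_raise[OF half_trig_mult[OF S Z], of "\<eta> - 1"] unfolding idx' .
    \<comment> \<open>\<open>?N / ?M\<close> is the first integral; its constancy gives
      \<open>E = Z * L c\<close>.\<close>
    let ?M = "\<lambda>\<theta>. S \<theta> * Z \<theta>" and ?N = "\<lambda>\<theta>. E \<theta> - C \<theta> * Z \<theta>"
    have dM: "deriv ?M \<theta> = C \<theta> / 2 * Z \<theta> + deriv Z \<theta> * S \<theta>" for \<theta>
      by (intro DERIV_imp_deriv DERIV_mult dS half_trig_deriv(1)[OF Z])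
    have dN: "deriv ?N \<theta> = deriv E \<theta> - (- S \<theta> / 2 * Z \<theta> + deriv Z \<theta> * C \<theta>)" for \<theta>
      by (intro DERIV_imp_deriv DERIV_diff DERIV_mult dC dE half_trig_deriv(1)[OF Z])
    have const: "deriv ?N \<theta> * ?M \<theta> = ?N \<theta> * deriv ?M \<theta>" for \<theta>
    proof -
      have "2 * (deriv ?N \<theta> * ?M \<theta> - ?N \<theta> * deriv ?M \<theta>)
          = B1 \<theta> * Z \<theta> + ((S \<theta>)\<^sup>2 + (C \<theta>)\<^sup>2) * (Z \<theta>)\<^sup>2 - A \<theta> * deriv Z \<theta>"
        unfolding dM dN A_def B1_def by (simp add: power2_eq_square algebra_simps)
      then show ?thesis unfolding SC ode by simp
    qed
    have "?M \<noteq> (\<lambda>_. 0)"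
    proof
      assume "?M = (\<lambda>_. 0)"
      then have "S = (\<lambda>_. 0)" using half_trig_mult_eq_0[OF S Z] False by (meson fun_cong)
      then have "S pi = 0" by simp
      then show False by (simp add: S_def)
    qed
    from half_trig_const_ratio[OF half_trig_diff[OF half_trig_raise[OF E, of d] CZ] SZ this const]
    obtain c where c: "\<And>\<theta>. E \<theta> - C \<theta> * Z \<theta> = c * (S \<theta> * Z \<theta>)" by blast
    have EZ: "E \<theta> = Z \<theta> * L c \<theta>" for \<theta>
      using c[of \<theta>] by (simp add: L_def algebra_simps)
    \<comment> \<open>A zero of \<open>L c\<close>. There some factor \<open>L (real k)\<close> of
      \<open>E\<close> vanishes too, and \<open>S \<phi> \<noteq> 0\<close> forces
      \<open>c = real k\<close>.\<close>
    define \<phi> where "\<phi> = 2 * (pi / 2 + arctan c)"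
    have S\<phi>: "S \<phi> \<noteq> 0"
      using cos_arctan_not_zero[of c] by (simp add: S_def \<phi>_def sin_add)
    have L\<phi>: "L c \<phi> = 0"
    proof -
      have "sin (arctan c) = tan (arctan c) * cos (arctan c)"
        using cos_arctan_not_zero[of c] unfolding tan_def by simp
      then show ?thesis by (simp add: L_def S_def C_def \<phi>_def sin_add cos_add tan_arctan)
    qed
    then have "E \<phi> = 0" by (simp add: EZ)
    then obtain k where k: "k < N - 1" "L (real k) \<phi> = 0"
    proof -
      have "L 0 \<phi> = 0 \<or> (\<exists>k<N-1. L (real k) \<phi> = 0)"
        using \<open>E \<phi> = 0\<close> by (auto simp: E_def)
      moreover have "0 < N - 1" using assms by simp
      ultimately show ?thesis using that by (metis of_nat_0)
    qed
    have "(real k - c) * S \<phi> = 0"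
      using k(2) L\<phi> unfolding L_def left_diff_distrib by linarith
    then have "c = real k" using S\<phi> by simp
    then have "(Z \<theta> - Y k \<theta>) * L (real k) \<theta> = 0" for \<theta>
      using EZ[of \<theta>] factor[OF k(1), of \<theta>] by auto
    moreover have "L (real k) \<noteq> (\<lambda>_. 0)" using half_trig_eq_0_iff[OF L] LP by blast
    moreover have "half_trig (2 * d + 2 * (\<eta> - 1)) (\<lambda>\<theta>. Z \<theta> - Y k \<theta>)
        (monom 1 (\<eta> - 1) * ZP - monom 1 d * YP k)"
      using half_trig_raise[OF Z, of "\<eta> - 1"] half_trig_raise[OF Y[OF k(1)], of d]
      by (intro half_trig_diff) (simp_all add: add.commute)
    ultimately have "(\<lambda>\<theta>. Z \<theta> - Y k \<theta>) = (\<lambda>_. 0)" using half_trig_mult_eq_0 L by blast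
    then have "Z = Y k" by (simp add: fun_eq_iff)
    then show ?thesis using k(1) by blast
  qed simp
  then have set: "riccati_solutions A (\<lambda>_. 0) B1 (\<lambda>_. 1) = insert (\<lambda>_. 0) (Y ` {..<N-1})"
    using sol zero by auto
  \<comment> \<open>At \<open>pi / 2\<close> all factors are positive, which separates the
    \<open>Y j\<close> from each other and from the zero solution.\<close>
  have Lpos: "L (real k) (pi / 2) > 0" for k
    using sin_gt_zero[of "pi / 4"] cos_gt_zero[of "pi / 4"]
    by (simp add: L_def S_def C_def add_pos_nonneg)
  have Epos: "E (pi / 2) > 0"
    unfolding E_def using Lpos Lpos[of 0] by (intro mult_pos_pos zero_less_power prod_pos) auto
  have "inj_on Y {..<N-1}"
  proof (rule inj_onI)
    fix i j assume ij: "i \<in> {..<N-1}" "j \<in> {..<N-1}" "Y i = Y j"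
    have "Y i (pi / 2) * L (real i) (pi / 2) = Y i (pi / 2) * L (real j) (pi / 2)"
      using factor[of i "pi / 2"] factor[of j "pi / 2"] ij by auto
    moreover have "Y i (pi / 2) \<noteq> 0" using factor[of i "pi / 2"] ij(1) Epos by auto
    ultimately have "L (real i) (pi / 2) = L (real j) (pi / 2)" by simp
    then have "(real i - real j) * S (pi / 2) = 0" unfolding L_def left_diff_distrib by linarith
    moreover have "S (pi / 2) \<noteq> 0" using sin_gt_zero[of "pi / 4"] by (simp add: S_def)
    ultimately show "i = j" by simp
  qed
  moreover have "(\<lambda>_. 0) \<notin> Y ` {..<N-1}"
  proof
    assume "(\<lambda>_. 0) \<in> Y ` {..<N-1}"
    then obtain j where "j < N - 1" "Y j = (\<lambda>_. 0)" by auto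
    then show False using factor[of j "pi / 2"] Epos by simp
  qed
  ultimately have "card (riccati_solutions A (\<lambda>_. 0) B1 (\<lambda>_. 1)) = N"
    using assms(1) by (simp add: set card_image)
  moreover have "finite (riccati_solutions A (\<lambda>_. 0) B1 (\<lambda>_. 1))" unfolding set by simp
  ultimately show ?thesis using eq by blast
qed

theorem theorem2:
  fixes \<eta> :: nat
  assumes "\<eta> \<ge> 1"
  shows "(\<forall>A B0 B1 B2. riccati_eq \<eta> A B0 B1 B2 \<and> B2 \<noteq> (\<lambda>_. 0) \<longrightarrow>
            finite (riccati_solutions A B0 B1 B2) \<and>
            card (riccati_solutions A B0 B1 B2) \<le> (if \<eta> = 1 then 3 else 2 * \<eta>)) \<and>
         (\<forall>N \<le> (if \<eta> = 1 then 3 else 2 * \<eta>). \<exists>A B0 B1 B2.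
            riccati_eq \<eta> A B0 B1 B2 \<and> B2 \<noteq> (\<lambda>_. 0) \<and>
            finite (riccati_solutions A B0 B1 B2) \<and>
            card (riccati_solutions A B0 B1 B2) = N)"
proof (rule conjI; intro allI impI)
  fix A B0 B1 B2 :: "real \<Rightarrow> real"
  assume "riccati_eq \<eta> A B0 B1 B2 \<and> B2 \<noteq> (\<lambda>_. 0)"
  then show "finite (riccati_solutions A B0 B1 B2) \<and>
      card (riccati_solutions A B0 B1 B2) \<le> (if \<eta> = 1 then 3 else 2 * \<eta>)"
    using riccati_solutions_bound[OF assms] by blast
next
  fix N assume N: "N \<le> (if \<eta> = 1 then 3 else 2 * \<eta>)"
  have const: "(\<lambda>_::real. c) \<noteq> (\<lambda>_. 0)" if "c \<noteq> 0" for c :: real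
    using that by (simp add: fun_eq_iff)
  \<comment> \<open>For \<open>\<eta> = 1\<close> the linear factors reach only
    \<open>N = 2\<close>, so three solutions need an equation of their own.\<close>
  consider "N = 0" | "N = 1" | "2 \<le> N" "N \<le> 2 * \<eta>" | "\<eta> = 1" "N = 3"
    using N by (force split: if_splits)
  then show "\<exists>A B0 B1 B2. riccati_eq \<eta> A B0 B1 B2 \<and> B2 \<noteq> (\<lambda>_. 0) \<and>
      finite (riccati_solutions A B0 B1 B2) \<and> card (riccati_solutions A B0 B1 B2) = N"
  proof cases
    case 1
    have "card {} = N" using 1 by simp
    then show ?thesis
      using riccati_no_solution[OF assms] const[OF one_neq_zero] finite.emptyI by metis
  next
    case 2
    have "(\<lambda>\<theta>. 2 + cos (real \<eta> * \<theta>)) \<noteq> (\<lambda>_. 0)"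
      using two_plus_cos_pos by (metis less_irrefl)
    moreover have "finite {\<lambda>_::real. 0 :: real}" "card {\<lambda>_::real. 0 :: real} = N"
      using 2 by simp_all
    ultimately show ?thesis using riccati_one_solution[OF assms] by metis
  next
    case 3
    then show ?thesis using riccati_linear_factors[of N \<eta>] const[OF one_neq_zero] by blast
  next
    case 4
    have "finite (riccati_solutions sin (\<lambda>_. 1) (\<lambda>_. 0) (\<lambda>_. - 1))"
      by (rule card_ge_0_finite) (simp add: riccati_three_solutions(2))
    moreover have "(\<lambda>_::real. - 1 :: real) \<noteq> (\<lambda>_. 0)" by (rule const) simp
    ultimately show ?thesis using riccati_three_solutions 4 by blast
  qed
qed

end
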